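(* Let $G$ be a finite-dimensional Lie group with Lie algebra $\mathfrak{g}$, let $K\trianglelefteq G$ be a closed normal Lie subgroup of co-dimension 1 with Lie algebra $\mathfrak{K}\subset\mathfrak{g}$, let $g_0,h_0\in G$ with $h_0\notin K$, let $\mathcal{U}\subset\mathbb{R}^m$ be a closed set of admissible controls, and let $f:\mathcal{U}\to\mathfrak{g}$. Consider the normal left-invariant hybrid control system $(G,Kg_0,\mathcal{U},f,r_{h_0})$ with dynamics $$\dot g=(\ell_g)_*f(u)\ \text{ for } g\notin Kg_0,\qquad g^+=r_{h_0}(g^-)=g^-h_0\ \text{ for } g^-\in Kg_0,$$ and the problem of minimizing, over controls $u(\cdot)$ and for a given initial state, the invariant cost $$J=\int_{t_0}^{t_f}\mathfrak{L}(u(t))\,dt+\varphi(g(t_f)),$$ where $\mathfrak{L}:\mathcal{U}\to\mathbb{R}$ and $\varphi:G\to\mathbb{R}$. Let $$\mathfrak{h}:\mathfrak{g}^*\to\mathbb{R},\qquad \mathfrak{h}(\mu)=\min_{u\in\mathcal{U}}\left[\mathfrak{L}(u)+\langle\mu,f(u)\rangle\right].$$ Let $g(t)$ be a regular optimal trajectory with co-state $p(t)\in T^*_{g(t)}G$ (in the sense of the hybrid maximum principle, see context), and set $\mu(t)=(\ell_{g(t)})^*p(t)\in\mathfrak{g}^*$ and $q(t)=\pi(g(t))\in K\backslash G$, where $\pi:G\to K\backslash G$ is the natural projection. Then $(q(t),\mu(t))$ follows the continuous dynamics $$\dot\mu=\mathrm{ad}^*_{d\mathfrak{h}(\mu)}\mu,\qquad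 \dot q=d\pi_{\sigma(q)}\left(\ell_{\sigma(q)}\right)_*d\mathfrak{h}(\mu),\qquad q\neq\pi(g_0),$$ where $\sigma:K\backslash G\to G$ is a local section of $\pi$, and the jump conditions $$\mu^+=\mathrm{Ad}^*_{h_0}\mu^-+\delta\mu,\qquad q^+=q^-\cdot\pi(h_0),\qquad \text{when } q^-=\pi(g_0),$$ where $\delta\mu\in\mathrm{Ann}(\mathfrak{K})$ is such that $\mathfrak{h}(\mu^+)=\mathfrak{h}(\mu^-)$.
   Context: Notation. $\ell_g(h)=gh$ and $r_g(h)=hg$ are left and right translation on $G$; lower $*$ denotes the derivative and upper $*$ the pullback of covectors, so $\langle(\ell_g)^*p,\xi\rangle=\langle p,(\ell_g)_*\xi\rangle$ for $p\in T_g^*G$, $\xi\in\mathfrak{g}$. For $\mu\in\mathfrak{g}^*$ and $\xi,\eta\in\mathfrak{g}$: $\langle\mathrm{ad}^*_\xi\mu,\eta\rangle=\langle\mu,[\xi,\eta]\rangle$ and $\langle\mathrm{Ad}^*_{h}\mu,\xi\rangle=\langle\mu,\mathrm{Ad}_{h}\xi\rangle$, i.e. $\mathrm{Ad}^*_{h}=(\ell_{h})^*(r_{h^{-1}})^*$. The differential $d\mathfrak{h}(\mu)$ is regarded as an element of $\mathfrak{g}\cong\mathfrak{g}^{**}$. $\mathrm{Ann}(\mathfrak{K})=\{\nu\in\mathfrak{g}^*:\langle\nu,\xi\rangle=0\ \forall\xi\in\mathfrak{K}\}$. Since $K$ is normal, $K\backslash G$ is a one-dimensional Lie group and $\pi$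 is a homomorphism; the product $q\cdot\pi(h_0)$ is taken in this group. Superscripts $-$ and $+$ denote values immediately before and after a reset. Hybrid system. The guard is the right coset $\Sigma=Kg_0$ and the reset is $\Delta=r_{h_0}|_\Sigma:\Sigma\to G$. The condition $h_0\notin K$ guarantees $\Delta(\Sigma)=Kg_0h_0\neq Kg_0$, so that reset events are isolated. Hybrid maximum principle and regular optimal trajectories. The Hamiltonian of the problem is $H:T^*G\to\mathbb{R}$, $$H(g,p)=\min_{u\in\mathcal{U}}\left[\langle p,(\ell_g)_*f(u)\rangle+\mathfrak{L}(u)\right],$$ which is assumed to be well defined and sufficiently smooth that Hamilton's equations make sense; it is left-invariant, with $H(e,\mu)=\mathfrak{h}(\mu)$. A regular optimal trajectory is an optimal hybrid arc $g(t)$ undergoing only finitely many resets and obeying the hybrid maximum principle: there is a co-state $p(t)\in T_{g(t)}^*G$ such that between resets $(g(t),p(t))$ satisfies Hamilton's equations $\dot g=\partial H/\partial p$, $\dot p=-\partial H/\partial g$ (for the canonical symplectic structure on $T^*G$), with terminal condition $p(t_f)=d\varphi_{g(t_f)}$, and at each reset, where $g^-\in\Sigma$ and $g^+=\Delta(g^-)$, the Hamiltonian jump condition holds: $$p^+\circ\Delta_*-p^-\in\mathrm{Ann}(T\Sigma),\qquad H(g^+,p^+)-H(g^-,p^-)=0.$$ Here $\Delta_*$ denotes the derivative $(r_{h_0})_*:T_{g^-}G\to T_{g^+}G$ of right translation, and $\mathrm{Ann}(T\Sigma)=\{(g,p)\in T^*G: g\in\Sigma,\ \langle p,T_g\Sigma\rangle=0\}$.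 *)

theory Defs
  imports "HOL-Analysis.Analysis" "HOL-Algebra.Coset"
begin

section \<open>Smooth manifolds\<close>

text \<open>
  A manifold is given by a topology together with one preferred chart \<^term>\<open>cmap M x\<close> on
  \<^term>\<open>cdom M x\<close> around each point \<open>x\<close>; these charts form a smooth atlas.  The tangent space at
  \<open>x\<close> is the model space \<^typ>\<open>'e\<close>, a tangent vector being identified with its coordinates in the
  preferred chart at \<open>x\<close>.  Cotangent vectors at \<open>x\<close> are accordingly elements of
  \<open>'e \<Rightarrow>\<^sub>L real\<close>.
\<close>

record ('a, 'e) manifold =
  mtop :: "'a topology"
  cdom :: "'a \<Rightarrow> 'a set"
  cmap :: "'a \<Rightarrow> 'a \<Rightarrow> 'e"

definition chart_inv :: "('a, 'e) manifold \<Rightarrow> 'a \<Rightarrow> 'e \<Rightarrow> 'a" where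
  "chart_inv M x = inv_into (cdom M x) (cmap M x)"

text \<open>\<open>C\<^sup>k\<close> on an open subset \<open>S\<close> of a finite-dimensional space.\<close>

primrec Ck_on :: "nat \<Rightarrow> ('e::euclidean_space \<Rightarrow> 'f::euclidean_space) \<Rightarrow> 'e set \<Rightarrow> bool" where
  "Ck_on 0 F S \<longleftrightarrow> continuous_on S F"
| "Ck_on (Suc k) F S \<longleftrightarrow>
     (\<forall>x\<in>S. F differentiable (at x)) \<and> (\<forall>v. Ck_on k (\<lambda>x. frechet_derivative F (at x) v) S)"

definition smooth_on :: "'e set \<Rightarrow> ('e::euclidean_space \<Rightarrow> 'f::euclidean_space) \<Rightarrow> bool" where
  "smooth_on S F \<longleftrightarrow> (\<forall>k. Ck_on k F S)"

definition smooth_manifold :: "('a, 'e::euclidean_space) manifold \<Rightarrow> bool" where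
  "smooth_manifold M \<longleftrightarrow>
     Hausdorff_space (mtop M) \<and> second_countable (mtop M) \<and>
     (\<forall>x\<in>topspace (mtop M).
        openin (mtop M) (cdom M x) \<and> x \<in> cdom M x \<and> open (cmap M x ` cdom M x) \<and>
        homeomorphic_map (subtopology (mtop M) (cdom M x))
          (top_of_set (cmap M x ` cdom M x)) (cmap M x)) \<and>
     (\<forall>x\<in>topspace (mtop M). \<forall>y\<in>topspace (mtop M).
        smooth_on (cmap M x ` (cdom M x \<inter> cdom M y)) (cmap M y \<circ> chart_inv M x))"

definition smooth_map_on ::
  "('a, 'e::euclidean_space) manifold \<Rightarrow> 'a set \<Rightarrow> ('b, 'f::euclidean_space) manifold
    \<Rightarrow> ('a \<Rightarrow> 'b) \<Rightarrow> bool" where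
  "smooth_map_on M S N F \<longleftrightarrow>
     openin (mtop M) S \<and> continuous_map (subtopology (mtop M) S) (mtop N) F \<and>
     (\<forall>x\<in>topspace (mtop M). \<forall>y\<in>topspace (mtop N).
        smooth_on (cmap M x ` (S \<inter> cdom M x \<inter> F -` cdom N y)) (cmap N y \<circ> F \<circ> chart_inv M x))"

abbreviation smooth_map ::
  "('a, 'e::euclidean_space) manifold \<Rightarrow> ('b, 'f::euclidean_space) manifold \<Rightarrow> ('a \<Rightarrow> 'b) \<Rightarrow> bool"
  where "smooth_map M N F \<equiv> smooth_map_on M (topspace (mtop M)) N F"

definition prod_manifold ::
  "('a, 'e) manifold \<Rightarrow> ('b, 'f) manifold \<Rightarrow> ('a \<times> 'b, 'e \<times> 'f) manifold" where
  "prod_manifold M N =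
     \<lparr>mtop = prod_topology (mtop M) (mtop N),
      cdom = (\<lambda>(x, y). cdom M x \<times> cdom N y),
      cmap = (\<lambda>(x, y) (a, b). (cmap M x a, cmap N y b))\<rparr>"

text \<open>The derivative \<open>T\<^sub>xM \<rightarrow> T\<^bsub>F x\<^esub>N\<close> of a map, and the differential of a real function.\<close>

definition mderiv ::
  "('a, 'e::euclidean_space) manifold \<Rightarrow> ('b, 'f::euclidean_space) manifold
    \<Rightarrow> ('a \<Rightarrow> 'b) \<Rightarrow> 'a \<Rightarrow> 'e \<Rightarrow>\<^sub>L 'f" where
  "mderiv M N F x =
     Blinfun (frechet_derivative (cmap N (F x) \<circ> F \<circ> chart_inv M x) (at (cmap M x x)))"

definition has_mdifferential ::
  "('a, 'e::euclidean_space) manifold \<Rightarrow> ('a \<Rightarrow> real) \<Rightarrow> ('e \<Rightarrow>\<^sub>L real) \<Rightarrow> 'a \<Rightarrow> bool" where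
  "has_mdifferential M F p x \<longleftrightarrow>
     ((F \<circ> chart_inv M x) has_derivative blinfun_apply p) (at (cmap M x x))"

definition has_velocity ::
  "('a, 'e::euclidean_space) manifold \<Rightarrow> (real \<Rightarrow> 'a) \<Rightarrow> 'e \<Rightarrow> real \<Rightarrow> bool" where
  "has_velocity M c v t \<longleftrightarrow>
     (\<forall>\<^sub>F s in nhds t. c s \<in> cdom M (c t)) \<and>
     ((\<lambda>s. cmap M (c t) (c s)) has_vector_derivative v) (at t)"

text \<open>
  Derivative at the point \<open>z\<close> of the change from chart \<open>x\<close> to chart \<open>y\<close>.  Thus
  \<^term>\<open>chart_trans M z a z\<close> sends a tangent vector at \<open>z\<close> to its coordinates in the chart \<open>a\<close>, and
  precomposition with \<^term>\<open>chart_trans M a z z\<close> does so for a cotangent vector at \<open>z\<close>.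
\<close>

definition chart_trans ::
  "('a, 'e::euclidean_space) manifold \<Rightarrow> 'a \<Rightarrow> 'a \<Rightarrow> 'a \<Rightarrow> 'e \<Rightarrow>\<^sub>L 'e" where
  "chart_trans M x y z = Blinfun (frechet_derivative (cmap M y \<circ> chart_inv M x) (at (cmap M x z)))"

text \<open>Lie bracket at \<open>a\<close> of vector fields, in the chart at \<open>a\<close>: \<open>[X,Y] = DY\<cdot>X - DX\<cdot>Y\<close>.\<close>

definition field_rep ::
  "('a, 'e::euclidean_space) manifold \<Rightarrow> 'a \<Rightarrow> ('a \<Rightarrow> 'e) \<Rightarrow> 'e \<Rightarrow> 'e" where
  "field_rep M a X y = (let x = chart_inv M a y in chart_trans M x a x (X x))"

definition lie_bracket ::
  "('a, 'e::euclidean_space) manifold \<Rightarrow> ('a \<Rightarrow> 'e) \<Rightarrow> ('a \<Rightarrow> 'e) \<Rightarrow> 'a \<Rightarrow> 'e" where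
  "lie_bracket M X Y a =
     frechet_derivative (field_rep M a Y) (at (cmap M a a)) (X a) -
     frechet_derivative (field_rep M a X) (at (cmap M a a)) (Y a)"

text \<open>\<open>k\<close>-dimensional embedded submanifolds, by slice charts of the maximal atlas.\<close>

definition smooth_chart ::
  "('a, 'e::euclidean_space) manifold \<Rightarrow> 'a set \<Rightarrow> ('a \<Rightarrow> 'e) \<Rightarrow> bool" where
  "smooth_chart M V \<psi> \<longleftrightarrow>
     openin (mtop M) V \<and> open (\<psi> ` V) \<and>
     homeomorphic_map (subtopology (mtop M) V) (top_of_set (\<psi> ` V)) \<psi> \<and>
     (\<forall>x\<in>topspace (mtop M).
        smooth_on (\<psi> ` (V \<inter> cdom M x)) (cmap M x \<circ> inv_into V \<psi>) \<and>
        smooth_on (cmap M x ` (V \<inter> cdom M x)) (\<psi> \<circ> chart_inv M x))"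

definition embedded_submanifold ::
  "('a, 'e::euclidean_space) manifold \<Rightarrow> nat \<Rightarrow> 'a set \<Rightarrow> bool" where
  "embedded_submanifold M k S \<longleftrightarrow>
     S \<subseteq> topspace (mtop M) \<and>
     (\<forall>x\<in>S. \<exists>V \<psi> W. smooth_chart M V \<psi> \<and> x \<in> V \<and> subspace W \<and> dim W = k \<and>
        \<psi> ` (V \<inter> S) = \<psi> ` V \<inter> W)"

text \<open>
  The tangent space at \<open>x\<close> of an embedded submanifold \<open>S\<close>, as a subspace of the tangent space of
  \<open>M\<close>: velocities of curves in \<open>S\<close>.
\<close>

definition tangent_space_of ::
  "('a, 'e::euclidean_space) manifold \<Rightarrow> 'a set \<Rightarrow> 'a \<Rightarrow> 'e set" where
  "tangent_space_of M S x = {v. \<exists>c. (\<forall>s. c s \<in> S) \<and> c 0 = x \<and> has_velocity M c v 0}"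

definition Ann :: "'e::real_normed_vector set \<Rightarrow> ('e \<Rightarrow>\<^sub>L real) set" where
  "Ann W = {\<nu>. \<forall>\<xi>\<in>W. blinfun_apply \<nu> \<xi> = 0}"

section \<open>Lie groups\<close>

definition lie_group :: "'a monoid \<Rightarrow> ('a, 'e::euclidean_space) manifold \<Rightarrow> bool" where
  "lie_group G M \<longleftrightarrow>
     group G \<and> smooth_manifold M \<and> topspace (mtop M) = carrier G \<and>
     smooth_map (prod_manifold M M) M (\<lambda>(x, y). x \<otimes>\<^bsub>G\<^esub> y) \<and>
     smooth_map M M (\<lambda>x. inv\<^bsub>G\<^esub> x)"

definition lmult :: "'a monoid \<Rightarrow> 'a \<Rightarrow> 'a \<Rightarrow> 'a" where
  "lmult G g h = g \<otimes>\<^bsub>G\<^esub> h"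

definition rmult :: "'a monoid \<Rightarrow> 'a \<Rightarrow> 'a \<Rightarrow> 'a" where
  "rmult G g h = h \<otimes>\<^bsub>G\<^esub> g"

definition lie_alg_bracket ::
  "'a monoid \<Rightarrow> ('a, 'e::euclidean_space) manifold \<Rightarrow> 'e \<Rightarrow> 'e \<Rightarrow> 'e" where
  "lie_alg_bracket G M \<xi> \<eta> =
     lie_bracket M (\<lambda>x. mderiv M M (lmult G x) \<one>\<^bsub>G\<^esub> \<xi>) (\<lambda>x. mderiv M M (lmult G x) \<one>\<^bsub>G\<^esub> \<eta>) \<one>\<^bsub>G\<^esub>"

definition coad ::
  "'a monoid \<Rightarrow> ('a, 'e::euclidean_space) manifold \<Rightarrow> 'e \<Rightarrow> ('e \<Rightarrow>\<^sub>L real) \<Rightarrow> ('e \<Rightarrow>\<^sub>L real)" where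
  "coad G M \<xi> \<mu> = Blinfun (\<lambda>\<eta>. blinfun_apply \<mu> (lie_alg_bracket G M \<xi> \<eta>))"

definition Adj ::
  "'a monoid \<Rightarrow> ('a, 'e::euclidean_space) manifold \<Rightarrow> 'a \<Rightarrow> 'e \<Rightarrow>\<^sub>L 'e" where
  "Adj G M h = mderiv M M (rmult G (inv\<^bsub>G\<^esub> h)) h o\<^sub>L mderiv M M (lmult G h) \<one>\<^bsub>G\<^esub>"

definition coAd ::
  "'a monoid \<Rightarrow> ('a, 'e::euclidean_space) manifold \<Rightarrow> 'a \<Rightarrow> ('e \<Rightarrow>\<^sub>L real) \<Rightarrow> ('e \<Rightarrow>\<^sub>L real)" where
  "coAd G M h \<mu> = \<mu> o\<^sub>L Adj G M h"

text \<open>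
  The element \<open>\<xi>\<close> of the Lie algebra representing the differential at \<open>\<mu>\<close> of a function on its dual.
\<close>

definition dual_differential ::
  "(('e::euclidean_space \<Rightarrow>\<^sub>L real) \<Rightarrow> real) \<Rightarrow> ('e \<Rightarrow>\<^sub>L real) \<Rightarrow> 'e" where
  "dual_differential F \<mu> = (THE \<xi>. \<forall>\<nu>. frechet_derivative F (at \<mu>) \<nu> = blinfun_apply \<nu> \<xi>)"

definition closed_normal_lie_subgroup ::
  "'a monoid \<Rightarrow> ('a, 'e::euclidean_space) manifold \<Rightarrow> nat \<Rightarrow> 'a set \<Rightarrow> bool" where
  "closed_normal_lie_subgroup G M k K \<longleftrightarrow>
     K \<lhd> G \<and> closedin (mtop M) K \<and> embedded_submanifold M k K"

definition qproj :: "'a monoid \<Rightarrow> 'a set \<Rightarrow> 'a \<Rightarrow> 'a set" where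
  "qproj G K g = K #>\<^bsub>G\<^esub> g"

text \<open>
  The smooth structure of the quotient group is characterised, uniquely up to the choice of atlas, by
  the projection being a smooth submersion.
\<close>

definition quotient_manifold ::
  "'a monoid \<Rightarrow> ('a, 'e::euclidean_space) manifold \<Rightarrow> 'a set
    \<Rightarrow> ('a set, 'f::euclidean_space) manifold \<Rightarrow> bool" where
  "quotient_manifold G M K Q \<longleftrightarrow>
     lie_group (G Mod K) Q \<and> smooth_map M Q (qproj G K) \<and>
     (\<forall>g\<in>carrier G. surj (blinfun_apply (mderiv M Q (qproj G K) g)))"

definition local_section ::
  "'a monoid \<Rightarrow> ('a, 'e::euclidean_space) manifold \<Rightarrow> 'a set
    \<Rightarrow> ('a set, 'f::euclidean_space) manifold \<Rightarrow> 'a set set \<Rightarrow> ('a set \<Rightarrow> 'a) \<Rightarrow> bool" where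
  "local_section G M K Q V \<sigma> \<longleftrightarrow>
     smooth_map_on Q V M \<sigma> \<and> (\<forall>q\<in>V. qproj G K (\<sigma> q) = q)"

section \<open>Hamilton's equations on the cotangent bundle\<close>

text \<open>
  A function \<open>H\<close> on the cotangent bundle, in the canonical coordinates induced by the chart \<open>a\<close>.
\<close>

definition cot_rep ::
  "('a, 'e::euclidean_space) manifold \<Rightarrow> ('a \<Rightarrow> ('e \<Rightarrow>\<^sub>L real) \<Rightarrow> real) \<Rightarrow> 'a
    \<Rightarrow> 'e \<times> ('e \<Rightarrow>\<^sub>L real) \<Rightarrow> real" where
  "cot_rep M H a = (\<lambda>(x, P). let y = chart_inv M a x in H y (P o\<^sub>L chart_trans M y a y))"

definition cot_differentiable ::
  "('a, 'e::euclidean_space) manifold \<Rightarrow> ('a \<Rightarrow> ('e \<Rightarrow>\<^sub>L real) \<Rightarrow> real) \<Rightarrow> bool" where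
  "cot_differentiable M H \<longleftrightarrow>
     (\<forall>a\<in>topspace (mtop M). \<forall>P. cot_rep M H a differentiable (at (cmap M a a, P)))"

definition cot_continuous_on ::
  "('a, 'e::euclidean_space) manifold \<Rightarrow> real set \<Rightarrow> (real \<Rightarrow> 'a) \<Rightarrow> (real \<Rightarrow> 'e \<Rightarrow>\<^sub>L real) \<Rightarrow> bool"
  where
  "cot_continuous_on M I g p \<longleftrightarrow>
     continuous_map (top_of_set I) (mtop M) g \<and>
     (\<forall>t\<in>I. continuous (at t within I) (\<lambda>s. p s o\<^sub>L chart_trans M (g t) (g s) (g s)))"

text \<open>
  \<open>dg/dt = \<partial>H/\<partial>p\<close> and \<open>dp/dt = - \<partial>H/\<partial>g\<close> at time \<open>t\<close>, in the canonical coordinates induced by the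
  chart at \<open>g t\<close>; there the coordinates of the curve at time \<open>t\<close> itself are
  \<open>(cmap M (g t) (g t), p t)\<close>.
\<close>

definition hamilton_equations ::
  "('a, 'e::euclidean_space) manifold \<Rightarrow> ('a \<Rightarrow> ('e \<Rightarrow>\<^sub>L real) \<Rightarrow> real)
    \<Rightarrow> (real \<Rightarrow> 'a) \<Rightarrow> (real \<Rightarrow> 'e \<Rightarrow>\<^sub>L real) \<Rightarrow> real \<Rightarrow> bool" where
  "hamilton_equations M H g p t \<longleftrightarrow>
     (let D = frechet_derivative (cot_rep M H (g t)) (at (cmap M (g t) (g t), p t)) in
      (\<exists>v. has_velocity M g v t \<and> (\<forall>\<nu>. blinfun_apply \<nu> v = D (0, \<nu>))) \<and>
      (\<exists>w. ((\<lambda>s. p s o\<^sub>L chart_trans M (g t) (g s) (g s)) has_vector_derivative w) (at t) \<and>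
           (\<forall>v. blinfun_apply w v = - D (v, 0))))"

section \<open>The hybrid control problem\<close>

text \<open>An absolutely continuous curve on a compact interval: locally, in charts, an indefinite integral.\<close>

definition ac_curve ::
  "('a, 'e::euclidean_space) manifold \<Rightarrow> real \<Rightarrow> real \<Rightarrow> (real \<Rightarrow> 'a) \<Rightarrow> bool" where
  "ac_curve M a b c \<longleftrightarrow>
     continuous_map (top_of_set {a..b}) (mtop M) c \<and>
     (\<forall>t\<in>{a..b}. \<exists>\<delta>>0. let a' = max a (t - \<delta>); b' = min b (t + \<delta>) in
        c ` {a'..b'} \<subseteq> cdom M (c t) \<and>
        (\<exists>v. v absolutely_integrable_on {a'..b'} \<and>
          (\<forall>s\<in>{a'..b'}. cmap M (c t) (c s) = cmap M (c t) (c a') + integral {a'..s} v)))"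

text \<open>
  A hybrid arc on \<open>[t0, tf]\<close> with \<open>N\<close> resets, at the times \<open>\<tau> 1 \<le> \<dots> \<le> \<tau> N\<close>, where
  \<open>\<tau> 0 = t0\<close> and \<open>\<tau> (N + 1) = tf\<close>: its piece \<open>g j\<close> lives on \<open>[\<tau> j, \<tau> (j + 1)]\<close>, so that
  \<^term>\<open>g j (\<tau> (Suc j))\<close> and \<^term>\<open>g (Suc j) (\<tau> (Suc j))\<close> are the states immediately before and
  after a reset.  Flow is confined to the complement of the guard.  Since the curve has one-sided
  limits everywhere and the guard and its image under the reset are distinct cosets, resets cannot
  accumulate, so a finite number of them is no restriction on arcs defined on all of \<open>[t0, tf]\<close>.
\<close>

definition hybrid_arc ::
  "'a monoid \<Rightarrow> ('a, 'e::euclidean_space) manifold \<Rightarrow> 'a set \<Rightarrow> 'a \<Rightarrow> 'a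
    \<Rightarrow> (real ^ 'm) set \<Rightarrow> (real ^ 'm \<Rightarrow> 'e) \<Rightarrow> real \<Rightarrow> real
    \<Rightarrow> nat \<Rightarrow> (nat \<Rightarrow> real) \<Rightarrow> (nat \<Rightarrow> real \<Rightarrow> 'a) \<Rightarrow> (real \<Rightarrow> real ^ 'm) \<Rightarrow> bool" where
  "hybrid_arc G M K g0 h0 U f t0 tf N \<tau> g u \<longleftrightarrow>
     \<tau> 0 = t0 \<and> \<tau> (Suc N) = tf \<and> (\<forall>j\<le>N. \<tau> j \<le> \<tau> (Suc j)) \<and>
     u \<in> borel_measurable (lebesgue_on {t0..tf}) \<and> (\<forall>t\<in>{t0..tf}. u t \<in> U) \<and>
     (\<forall>j\<le>N. ac_curve M (\<tau> j) (\<tau> (Suc j)) (g j) \<and>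
        (\<forall>t\<in>{\<tau> j..<\<tau> (Suc j)}. g j t \<notin> K #>\<^bsub>G\<^esub> g0) \<and>
        (AE t in lebesgue_on {\<tau> j<..<\<tau> (Suc j)}.
           has_velocity M (g j) (mderiv M M (lmult G (g j t)) \<one>\<^bsub>G\<^esub> (f (u t))) t)) \<and>
     (\<forall>j<N. g j (\<tau> (Suc j)) \<in> K #>\<^bsub>G\<^esub> g0 \<and>
        g (Suc j) (\<tau> (Suc j)) = rmult G h0 (g j (\<tau> (Suc j))))"

definition optimal_arc ::
  "'a monoid \<Rightarrow> ('a, 'e::euclidean_space) manifold \<Rightarrow> 'a set \<Rightarrow> 'a \<Rightarrow> 'a
    \<Rightarrow> (real ^ 'm) set \<Rightarrow> (real ^ 'm \<Rightarrow> 'e) \<Rightarrow> (real ^ 'm \<Rightarrow> real) \<Rightarrow> ('a \<Rightarrow> real) \<Rightarrow> real \<Rightarrow> real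
    \<Rightarrow> nat \<Rightarrow> (nat \<Rightarrow> real) \<Rightarrow> (nat \<Rightarrow> real \<Rightarrow> 'a) \<Rightarrow> (real \<Rightarrow> real ^ 'm) \<Rightarrow> bool" where
  "optimal_arc G M K g0 h0 U f L \<phi> t0 tf N \<tau> g u \<longleftrightarrow>
     hybrid_arc G M K g0 h0 U f t0 tf N \<tau> g u \<and>
     integrable (lebesgue_on {t0..tf}) (\<lambda>t. L (u t)) \<and>
     (\<forall>N' \<tau>' g' u'.
        hybrid_arc G M K g0 h0 U f t0 tf N' \<tau>' g' u' \<and>
        integrable (lebesgue_on {t0..tf}) (\<lambda>t. L (u' t)) \<and>
        g' 0 t0 = g 0 t0 \<longrightarrow>
        (LINT t|lebesgue_on {t0..tf}. L (u t)) + \<phi> (g N tf)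
          \<le> (LINT t|lebesgue_on {t0..tf}. L (u' t)) + \<phi> (g' N' tf))"

definition control_hamiltonian ::
  "'a monoid \<Rightarrow> ('a, 'e::euclidean_space) manifold
    \<Rightarrow> (real ^ 'm) set \<Rightarrow> (real ^ 'm \<Rightarrow> 'e) \<Rightarrow> (real ^ 'm \<Rightarrow> real)
    \<Rightarrow> 'a \<Rightarrow> ('e \<Rightarrow>\<^sub>L real) \<Rightarrow> real" where
  "control_hamiltonian G M U f L g p =
     (LEAST c. c \<in> (\<lambda>u. blinfun_apply p (mderiv M M (lmult G g) \<one>\<^bsub>G\<^esub> (f u)) + L u) ` U)"

definition hamiltonian_well_defined ::
  "'a monoid \<Rightarrow> ('a, 'e::euclidean_space) manifold
    \<Rightarrow> (real ^ 'm) set \<Rightarrow> (real ^ 'm \<Rightarrow> 'e) \<Rightarrow> (real ^ 'm \<Rightarrow> real) \<Rightarrow> bool" where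
  "hamiltonian_well_defined G M U f L \<longleftrightarrow>
     (\<forall>g\<in>carrier G. \<forall>p. \<exists>u\<in>U. \<forall>v\<in>U.
        blinfun_apply p (mderiv M M (lmult G g) \<one>\<^bsub>G\<^esub> (f u)) + L u
          \<le> blinfun_apply p (mderiv M M (lmult G g) \<one>\<^bsub>G\<^esub> (f v)) + L v)"

definition reduced_hamiltonian ::
  "(real ^ 'm) set \<Rightarrow> (real ^ 'm \<Rightarrow> 'e::euclidean_space) \<Rightarrow> (real ^ 'm \<Rightarrow> real)
    \<Rightarrow> ('e \<Rightarrow>\<^sub>L real) \<Rightarrow> real" where
  "reduced_hamiltonian U f L \<mu> = (LEAST c. c \<in> (\<lambda>u. L u + blinfun_apply \<mu> (f u)) ` U)"

definition hybrid_maximum_principle ::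
  "'a monoid \<Rightarrow> ('a, 'e::euclidean_space) manifold \<Rightarrow> 'a set \<Rightarrow> 'a \<Rightarrow> 'a
    \<Rightarrow> ('a \<Rightarrow> ('e \<Rightarrow>\<^sub>L real) \<Rightarrow> real) \<Rightarrow> ('a \<Rightarrow> real)
    \<Rightarrow> nat \<Rightarrow> (nat \<Rightarrow> real) \<Rightarrow> (nat \<Rightarrow> real \<Rightarrow> 'a) \<Rightarrow> (nat \<Rightarrow> real \<Rightarrow> 'e \<Rightarrow>\<^sub>L real) \<Rightarrow> bool" where
  "hybrid_maximum_principle G M K g0 h0 H \<phi> N \<tau> g p \<longleftrightarrow>
     (\<forall>j\<le>N. cot_continuous_on M {\<tau> j..\<tau> (Suc j)} (g j) (p j) \<and>
        (\<forall>t\<in>{\<tau> j<..<\<tau> (Suc j)}. hamilton_equations M H (g j) (p j) t)) \<and>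
     has_mdifferential M \<phi> (p N (\<tau> (Suc N))) (g N (\<tau> (Suc N))) \<and>
     (\<forall>j<N. let gm = g j (\<tau> (Suc j)); pm = p j (\<tau> (Suc j));
                gp = g (Suc j) (\<tau> (Suc j)); pp = p (Suc j) (\<tau> (Suc j)) in
        (pp o\<^sub>L mderiv M M (rmult G h0) gm) - pm \<in> Ann (tangent_space_of M (K #>\<^bsub>G\<^esub> g0) gm) \<and>
        H gp pp - H gm pm = 0)"

definition regular_optimal_trajectory ::
  "'a monoid \<Rightarrow> ('a, 'e::euclidean_space) manifold \<Rightarrow> 'a set \<Rightarrow> 'a \<Rightarrow> 'a
    \<Rightarrow> (real ^ 'm) set \<Rightarrow> (real ^ 'm \<Rightarrow> 'e) \<Rightarrow> (real ^ 'm \<Rightarrow> real) \<Rightarrow> ('a \<Rightarrow> real) \<Rightarrow> real \<Rightarrow> real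
    \<Rightarrow> nat \<Rightarrow> (nat \<Rightarrow> real) \<Rightarrow> (nat \<Rightarrow> real \<Rightarrow> 'a) \<Rightarrow> (nat \<Rightarrow> real \<Rightarrow> 'e \<Rightarrow>\<^sub>L real) \<Rightarrow> bool" where
  "regular_optimal_trajectory G M K g0 h0 U f L \<phi> t0 tf N \<tau> g p \<longleftrightarrow>
     (\<exists>u. optimal_arc G M K g0 h0 U f L \<phi> t0 tf N \<tau> g u) \<and>
     hybrid_maximum_principle G M K g0 h0 (control_hamiltonian G M U f L) \<phi> N \<tau> g p"

end

theory Submission
  imports Defs
begin

text \<open>
  Left invariance means that the Hamiltonian is \<open>\<hh>\<close> composed with left trivialisation.  In a chart
  around \<open>a = g(t)\<close> write \<open>A(x)\<close> for the derivative at the identity of left translation by the point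
  with coordinates \<open>x\<close>; then \<open>H(x,P) = \<hh>(P \<circ> A(x))\<close> and \<open>\<mu> = P \<circ> A(x)\<close>.  Hamilton's equations give
  \<open>dx/dt = A \<xi>\<close> and \<open>dP/dt = - P (DA(\<cdot>) \<xi>)\<close> with \<open>\<xi> = d\<hh>(\<mu>)\<close>, hence
  \<open>d\<mu>/dt(\<eta>) = P (DA(A \<xi>) \<eta> - DA(A \<eta>) \<xi>)\<close>, and the bracket on the right is \<open>A [\<xi>,\<eta>]\<close> because left
  translations preserve brackets of left-invariant fields.  The velocity of \<open>q = \<pi>(g)\<close> does not
  depend on the lift of \<open>q\<close> since \<open>\<pi> \<circ> \<ell>\<^bsub>kg\<^esub> = \<pi> \<circ> \<ell>\<^sub>g\<close> for \<open>k \<in> K\<close>.  At a reset the factorisation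
  \<open>\<ell>\<^bsub>gh\<^esub> = r\<^sub>h \<circ> \<ell>\<^sub>g \<circ> (r\<^bsub>h\<^sup>-\<^sup>1\<^esub> \<circ> \<ell>\<^sub>h)\<close> turns the jump of the co-state into a coadjoint action plus
  a term vanishing on the Lie algebra of \<open>K\<close>, because \<open>\<ell>\<^sub>g \<circ> r\<^bsub>h\<^sup>-\<^sup>1\<^esub> \<circ> \<ell>\<^sub>h\<close> maps \<open>K\<close> to the guard.
\<close>

section \<open>Calculus\<close>

text \<open>On a finite-dimensional space an operator is a finite sum of bounded linear images of
  its values on the basis. Smoothness is defined one direction at a time, and this passes to
  operator-valued derivatives.\<close>

lemma differentiable_blinfun_componentwise:
  fixes A :: "'x::real_normed_vector \<Rightarrow> 'e::euclidean_space \<Rightarrow>\<^sub>L 'f::real_normed_vector"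
  assumes "\<And>b. b \<in> Basis \<Longrightarrow> (\<lambda>x. A x b) differentiable F"
  shows "A differentiable F"
proof -
  have "A = (\<lambda>x. \<Sum>b\<in>Basis. blinfun_scaleR_left (A x b) o\<^sub>L blinfun_inner_left b)"
  proof (intro ext blinfun_eqI)
    fix x v
    have "(\<Sum>b\<in>Basis. (v \<bullet> b) *\<^sub>R A x b) = A x (\<Sum>b\<in>Basis. (v \<bullet> b) *\<^sub>R b)"
      by (simp add: blinfun.sum_right blinfun.scaleR_right)
    then show "A x v = (\<Sum>b\<in>Basis. blinfun_scaleR_left (A x b) o\<^sub>L blinfun_inner_left b) v"
      by (simp add: blinfun.sum_left euclidean_representation blinfun_inner_left.rep_eq)
  qed
  moreover have "(\<lambda>x. \<Sum>b\<in>Basis. blinfun_scaleR_left (A x b) o\<^sub>L blinfun_inner_left b) differentiable F"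
  proof (rule differentiable_sum)
    show "\<forall>b\<in>Basis. (\<lambda>x. blinfun_scaleR_left (A x b) o\<^sub>L blinfun_inner_left b) differentiable F"
    proof
      fix b :: 'e assume "b \<in> Basis"
      then obtain D where D: "((\<lambda>x. A x b) has_derivative D) F"
        using assms differentiable_def by blast
      have "bounded_linear (\<lambda>y::'f. blinfun_scaleR_left y o\<^sub>L blinfun_inner_left b)"
        by (intro bounded_linear_intros)
      from bounded_linear.has_derivative[OF this D]
      show "(\<lambda>x. blinfun_scaleR_left (A x b) o\<^sub>L blinfun_inner_left b) differentiable F"
        unfolding differentiable_def by blast
    qed
  qed simp
  ultimately show ?thesis by simp
qed

section \<open>Symmetry of second derivatives\<close>

text \<open>The second difference is an increment, over \<open>s\<close> from \<open>0\<close> to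
  \<open>t\<close>, of a first difference in direction \<open>k\<close>. The mean value inequality
  reduces the estimate to the linear approximation of \<open>f'\<close> at the single point
  \<open>x0\<close>.\<close>

lemma second_difference_bound:
  fixes f :: "'a::real_normed_vector \<Rightarrow> 'b::real_normed_vector" and f' :: "'a \<Rightarrow> 'a \<Rightarrow>\<^sub>L 'b"
  assumes "open S" "x0 \<in> S"
    and f': "\<And>x. x \<in> S \<Longrightarrow> (f has_derivative f' x) (at x)"
    and f'': "(f' has_derivative f'') (at x0)"
    and "e > 0"
  shows "\<exists>d>0. \<forall>t. 0 < t \<and> t < d \<longrightarrow>
    norm (f (x0 + t *\<^sub>R h + t *\<^sub>R k) - f (x0 + t *\<^sub>R h) - f (x0 + t *\<^sub>R k) + f x0
      - (t * t) *\<^sub>R f'' k h) \<le> e * (t * t)"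
proof -
  \<comment> \<open>\<open>C - 1\<close> is the constant that the mean value inequality produces
    below; the summand 1 keeps \<open>C\<close> positive, so that \<open>e / C\<close> makes
    sense.\<close>
  define C where "C = (2 * norm h + 2 * norm k) * norm h + 1"
  have "C > 0" unfolding C_def by (simp add: add_nonneg_pos)
  define e' where "e' = e / C"
  have "e' > 0" using \<open>e > 0\<close> \<open>C > 0\<close> by (simp add: e'_def)
  obtain r where r: "r > 0" "ball x0 r \<subseteq> S"
    using assms(1,2) open_contains_ball by blast
  have inS: "x0 + v \<in> S" if "norm v < r" for v
    using that by (intro subsetD[OF r(2)]) (simp add: dist_norm)
  from f'' \<open>e' > 0\<close> obtain r' where r': "r' > 0"
    and b: "\<And>y. norm (y - x0) < r' \<Longrightarrow> norm (f' y - f' x0 - f'' (y - x0)) \<le> e' * norm (y - x0)"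
    unfolding has_derivative_at_alt by blast
  interpret f'': bounded_linear f'' using f'' by (rule has_derivative_bounded_linear)
  define c where "c = norm h + norm k + 1"
  have "c > 0" by (simp add: c_def add_nonneg_pos)
  define d where "d = min r r' / c"
  have "d > 0" using r r' \<open>c > 0\<close> by (simp add: d_def)
  moreover
  { fix t :: real assume t: "0 < t" "t < d"
    have dc: "t * c < min r r'" using t \<open>c > 0\<close> by (simp add: d_def field_simps)
    have small: "norm (s *\<^sub>R h + u *\<^sub>R k) \<le> t * (norm h + norm k)"
      "norm (s *\<^sub>R h + u *\<^sub>R k) < r" "norm (s *\<^sub>R h + u *\<^sub>R k) < r'"
      if "0 \<le> s" "s \<le> t" "0 \<le> u" "u \<le> t" for s u
    proof -
      have "norm (s *\<^sub>R h + u *\<^sub>R k) \<le> s * norm h + u * norm k"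
        using norm_triangle_ineq[of "s *\<^sub>R h" "u *\<^sub>R k"] that by simp
      also have "\<dots> \<le> t * norm h + t * norm k"
        using that by (intro add_mono mult_right_mono) auto
      finally show 1: "norm (s *\<^sub>R h + u *\<^sub>R k) \<le> t * (norm h + norm k)"
        by (simp add: algebra_simps)
      moreover have "t * (norm h + norm k) < t * c" using t by (simp add: c_def)
      ultimately show "norm (s *\<^sub>R h + u *\<^sub>R k) < r" "norm (s *\<^sub>R h + u *\<^sub>R k) < r'"
        using dc by auto
    qed
    \<comment> \<open>The expected linear growth in \<open>s\<close> is subtracted, so that
      \<open>\<phi> t - \<phi> 0\<close> is exactly the quantity to be bounded and the derivative of
      \<open>\<phi>\<close> is small.\<close>
    define \<phi> where "\<phi> s = f (x0 + (s *\<^sub>R h + t *\<^sub>R k)) - f (x0 + s *\<^sub>R h) - s *\<^sub>R (t *\<^sub>R f'' k h)" for s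
    define \<phi>' where "\<phi>' s = (\<lambda>w. w *\<^sub>R (f' (x0 + (s *\<^sub>R h + t *\<^sub>R k)) h - f' (x0 + s *\<^sub>R h) h - t *\<^sub>R f'' k h))" for s
    have der: "(\<phi> has_derivative \<phi>' s) (at s within {0..t})" if s: "s \<in> {0..t}" for s
    proof -
      have "x0 + (s *\<^sub>R h + t *\<^sub>R k) \<in> S" "x0 + s *\<^sub>R h \<in> S"
        using small(2)[of s t] small(2)[of s 0] s t
        by (auto intro!: inS)
      then have 1: "(f has_derivative f' (x0 + (s *\<^sub>R h + t *\<^sub>R k))) (at (x0 + (s *\<^sub>R h + t *\<^sub>R k)))"
        and 2: "(f has_derivative f' (x0 + s *\<^sub>R h)) (at (x0 + s *\<^sub>R h))"
        using f' by auto
      have 3: "((\<lambda>s. f (x0 + (s *\<^sub>R h + t *\<^sub>R k))) has_derivative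
          (\<lambda>w. f' (x0 + (s *\<^sub>R h + t *\<^sub>R k)) (w *\<^sub>R h))) (at s within {0..t})"
        by (rule has_derivative_compose[where g = f and f = "\<lambda>s. x0 + (s *\<^sub>R h + t *\<^sub>R k)", OF _ 1]) (auto intro!: derivative_eq_intros)
      have 4: "((\<lambda>s. f (x0 + s *\<^sub>R h)) has_derivative
          (\<lambda>w. f' (x0 + s *\<^sub>R h) (w *\<^sub>R h))) (at s within {0..t})"
        by (rule has_derivative_compose[where g = f and f = "\<lambda>s. x0 + s *\<^sub>R h", OF _ 2]) (auto intro!: derivative_eq_intros)
      have 5: "((\<lambda>s. s *\<^sub>R (t *\<^sub>R f'' k h)) has_derivative (\<lambda>w. w *\<^sub>R (t *\<^sub>R f'' k h))) (at s within {0..t})"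
        by (auto intro!: derivative_eq_intros)
      from has_derivative_diff[OF has_derivative_diff[OF 3 4] 5]
      show ?thesis unfolding \<phi>_def \<phi>'_def
        by (simp add: blinfun.scaleR_right scaleR_diff_right)
    qed
    have bd: "onorm (\<phi>' s) \<le> e' * (t * (2 * norm h + 2 * norm k)) * norm h" if s: "s \<in> {0..t}" for s
    proof -
      \<comment> \<open>\<open>?A\<close> and \<open>?B\<close> are the errors in linearising
        \<open>f'\<close> at \<open>x0\<close>; in their difference the terms \<open>f' x0\<close>
        and \<open>f'' (s *\<^sub>R h)\<close> cancel, which leaves the derivative of
        \<open>\<phi>\<close>.\<close>
      let ?A = "f' (x0 + (s *\<^sub>R h + t *\<^sub>R k)) - f' x0 - f'' (s *\<^sub>R h + t *\<^sub>R k)"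
      let ?B = "f' (x0 + s *\<^sub>R h) - f' x0 - f'' (s *\<^sub>R h)"
      have "norm ?A \<le> e' * norm (s *\<^sub>R h + t *\<^sub>R k)"
        using b[of "x0 + (s *\<^sub>R h + t *\<^sub>R k)"] small(3)[of s t] s by simp
      also have "\<dots> \<le> e' * (t * (norm h + norm k))"
        using small(1)[of s t] s \<open>e' > 0\<close> by (intro mult_left_mono) auto
      finally have A: "norm ?A \<le> e' * (t * (norm h + norm k))" .
      have "norm ?B \<le> e' * norm (s *\<^sub>R h + 0 *\<^sub>R k)"
        using b[of "x0 + s *\<^sub>R h"] small(3)[of s 0] s by simp
      also have "\<dots> \<le> e' * (t * (norm h + norm k))"
        using small(1)[of s 0] s \<open>e' > 0\<close> by (intro mult_left_mono) auto
      finally have B: "norm ?B \<le> e' * (t * (norm h + norm k))" .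
      have AB: "norm (?A - ?B) \<le> e' * (t * (2 * norm h + 2 * norm k))"
        using norm_triangle_ineq4[of ?A ?B] A B by (simp add: algebra_simps)
      have eq: "f' (x0 + (s *\<^sub>R h + t *\<^sub>R k)) h - f' (x0 + s *\<^sub>R h) h - t *\<^sub>R f'' k h = (?A - ?B) h"
        by (simp add: blinfun.bilinear_simps f''.add f''.scaleR)
      have n: "norm (f' (x0 + (s *\<^sub>R h + t *\<^sub>R k)) h - f' (x0 + s *\<^sub>R h) h - t *\<^sub>R f'' k h)
          \<le> e' * (t * (2 * norm h + 2 * norm k)) * norm h"
        unfolding eq using norm_blinfun[of "?A - ?B" h] AB
        by (meson mult_right_mono norm_ge_zero order_trans)
      show ?thesis unfolding \<phi>'_def
        by (rule onorm_le) (use n in \<open>auto intro: mult_left_mono simp: mult.commute[of _ "\<bar>_\<bar>"]\<close>)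
    qed
    have "norm (\<phi> t - \<phi> 0) \<le> e' * (t * (2 * norm h + 2 * norm k)) * norm h * norm (t - 0)"
      by (rule differentiable_bound[OF _ der bd]) (use t in auto)
    also have "\<dots> = e' * (C - 1) * (t * t)" using t by (simp add: C_def)
    also have "\<dots> \<le> e' * C * (t * t)" using \<open>e' > 0\<close> t by (simp add: mult_right_mono)
    also have "\<dots> = e * (t * t)" using \<open>C > 0\<close> by (simp add: e'_def)
    finally have "norm (f (x0 + t *\<^sub>R h + t *\<^sub>R k) - f (x0 + t *\<^sub>R h) - f (x0 + t *\<^sub>R k) + f x0
      - (t * t) *\<^sub>R f'' k h) \<le> e * (t * t)"
      by (simp add: \<phi>_def algebra_simps)
  }
  ultimately show ?thesis by blast
qed

text \<open>The second difference is unchanged when \<open>h\<close> and \<open>k\<close> are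
  swapped, while its quotient by \<open>t * t\<close> approaches \<open>f'' k h\<close> in one order
  and \<open>f'' h k\<close> in the other.\<close>

lemma symmetric_second_derivative:
  fixes f :: "'a::real_normed_vector \<Rightarrow> 'b::real_normed_vector" and f' :: "'a \<Rightarrow> 'a \<Rightarrow>\<^sub>L 'b"
  assumes "open S" "x0 \<in> S"
    and "\<And>x. x \<in> S \<Longrightarrow> (f has_derivative f' x) (at x)"
    and "(f' has_derivative f'') (at x0)"
  shows "f'' h k = f'' k h"
proof -
  have "norm (f'' h k - f'' k h) \<le> e" if "e > 0" for e
  proof -
    have "e / 2 > 0" using that by simp
    note B = second_difference_bound[OF assms this]
    obtain d1 where d1: "d1 > 0" "\<And>t. 0 < t \<Longrightarrow> t < d1 \<Longrightarrow>
      norm (f (x0 + t *\<^sub>R h + t *\<^sub>R k) - f (x0 + t *\<^sub>R h) - f (x0 + t *\<^sub>R k) + f x0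
      - (t * t) *\<^sub>R f'' k h) \<le> e / 2 * (t * t)" using B[of h k] by blast
    obtain d2 where d2: "d2 > 0" "\<And>t. 0 < t \<Longrightarrow> t < d2 \<Longrightarrow>
      norm (f (x0 + t *\<^sub>R k + t *\<^sub>R h) - f (x0 + t *\<^sub>R k) - f (x0 + t *\<^sub>R h) + f x0
      - (t * t) *\<^sub>R f'' h k) \<le> e / 2 * (t * t)" using B[of k h] by blast
    define t where "t = min d1 d2 / 2"
    have t: "0 < t" "t < d1" "t < d2" using d1(1) d2(1) by (auto simp: t_def)
    let ?S = "f (x0 + t *\<^sub>R h + t *\<^sub>R k) - f (x0 + t *\<^sub>R h) - f (x0 + t *\<^sub>R k) + f x0"
    have 1: "norm (?S - (t * t) *\<^sub>R f'' k h) \<le> e / 2 * (t * t)" using d1(2) t by blast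
    have "f (x0 + t *\<^sub>R k + t *\<^sub>R h) - f (x0 + t *\<^sub>R k) - f (x0 + t *\<^sub>R h) + f x0 = ?S"
      by (simp add: algebra_simps)
    then have 2: "norm (?S - (t * t) *\<^sub>R f'' h k) \<le> e / 2 * (t * t)" using d2(2) t by metis
    have eq: "(t * t) *\<^sub>R (f'' h k - f'' k h) =
      (?S - (t * t) *\<^sub>R f'' k h) - (?S - (t * t) *\<^sub>R f'' h k)"
      by (simp add: algebra_simps)
    have "norm ((t * t) *\<^sub>R (f'' h k - f'' k h))
        \<le> norm (?S - (t * t) *\<^sub>R f'' k h) + norm (?S - (t * t) *\<^sub>R f'' h k)"
      unfolding eq by (rule norm_triangle_ineq4)
    also have "\<dots> \<le> e / 2 * (t * t) + e / 2 * (t * t)"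
      using 1 2 by (rule add_mono)
    finally have "norm ((t * t) *\<^sub>R (f'' h k - f'' k h)) \<le> e / 2 * (t * t) + e / 2 * (t * t)" .
    then have "(t * t) * norm (f'' h k - f'' k h) \<le> (t * t) * e"
      unfolding norm_scaleR using t by (simp add: mult_ac)
    then show ?thesis using t by (simp add: mult_le_cancel_left)
  qed
  then have "norm (f'' h k - f'' k h) \<le> 0" by (rule field_le_epsilon) simp
  then show ?thesis by simp
qed

lemma smooth_on_differentiable:
  assumes "smooth_on S F" "x \<in> S"
  shows "F differentiable (at x)" "(\<lambda>x. frechet_derivative F (at x) v) differentiable (at x)"
proof -
  have "Ck_on 2 F S" using assms unfolding smooth_on_def by blast
  then show "F differentiable (at x)" "(\<lambda>x. frechet_derivative F (at x) v) differentiable (at x)"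
    using assms(2) by (auto simp: numeral_2_eq_2)
qed

text \<open>This is reflexivity in finite dimension: the values of the derivative on the dual basis
  \<open>blinfun_inner_left b\<close> are the coordinates of a representing vector, and these
  functionals separate points, so the description by \<open>THE\<close> is proper.\<close>

lemma dual_differential_works:
  fixes F :: "('e::euclidean_space \<Rightarrow>\<^sub>L real) \<Rightarrow> real"
  assumes "F differentiable (at \<mu>)"
  shows "frechet_derivative F (at \<mu>) \<nu> = \<nu> (dual_differential F \<mu>)"
proof -
  define D where "D = frechet_derivative F (at \<mu>)"
  interpret D: bounded_linear D
    using assms by (metis D_def frechet_derivative_works has_derivative_bounded_linear)
  define \<xi> where "\<xi> = (\<Sum>b\<in>Basis. D (blinfun_inner_left b) *\<^sub>R b)"
  have \<xi>: "D \<nu> = \<nu> \<xi>" for \<nu>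
  proof -
    have "\<nu> = (\<Sum>b\<in>Basis. \<nu> b *\<^sub>R blinfun_inner_left b)"
    proof (rule blinfun_euclidean_eqI)
      fix i :: 'e assume "i \<in> Basis"
      then show "\<nu> i = (\<Sum>b\<in>Basis. \<nu> b *\<^sub>R blinfun_inner_left b) i"
        by (simp add: blinfun.sum_left blinfun.scaleR_left blinfun_inner_left.rep_eq inner_Basis
            if_distrib sum.delta cong: if_cong)
    qed
    then have "D \<nu> = (\<Sum>b\<in>Basis. \<nu> b *\<^sub>R D (blinfun_inner_left b))"
      by (metis (no_types, lifting) D.scaleR D.sum sum.cong)
    then show ?thesis
      by (simp add: \<xi>_def blinfun.sum_right blinfun.scaleR_right mult.commute)
  qed
  have "dual_differential F \<mu> = \<xi>"
    unfolding dual_differential_def D_def[symmetric]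
  proof (rule the_equality)
    fix \<zeta> assume \<zeta>: "\<forall>\<nu>. D \<nu> = blinfun_apply \<nu> \<zeta>"
    show "\<zeta> = \<xi>"
    proof (rule euclidean_eqI)
      fix b :: 'e assume "b \<in> Basis"
      show "\<zeta> \<bullet> b = \<xi> \<bullet> b" using \<zeta> \<xi> by (metis blinfun_inner_left.rep_eq)
    qed
  qed (use \<xi> in blast)
  then show ?thesis using \<xi> D_def by simp
qed

section \<open>Charts and derivatives on manifolds\<close>

lemma openin_cdom: "smooth_manifold M \<Longrightarrow> x \<in> topspace (mtop M) \<Longrightarrow> openin (mtop M) (cdom M x)"
  and mem_cdom: "smooth_manifold M \<Longrightarrow> x \<in> topspace (mtop M) \<Longrightarrow> x \<in> cdom M x"
  and open_chart_range: "smooth_manifold M \<Longrightarrow> x \<in> topspace (mtop M) \<Longrightarrow> open (cmap M x ` cdom M x)"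
  and homeomorphic_map_cmap: "smooth_manifold M \<Longrightarrow> x \<in> topspace (mtop M) \<Longrightarrow>
    homeomorphic_map (subtopology (mtop M) (cdom M x)) (top_of_set (cmap M x ` cdom M x)) (cmap M x)"
  unfolding smooth_manifold_def by auto

lemma cdom_subset_topspace:
  "smooth_manifold M \<Longrightarrow> x \<in> topspace (mtop M) \<Longrightarrow> cdom M x \<subseteq> topspace (mtop M)"
  by (rule openin_subset[OF openin_cdom])

lemma inj_on_cmap: "smooth_manifold M \<Longrightarrow> x \<in> topspace (mtop M) \<Longrightarrow> inj_on (cmap M x) (cdom M x)"
  using homeomorphic_imp_injective_map[OF homeomorphic_map_cmap, of M x] cdom_subset_topspace[of M x]
  by (simp add: Int_absorb1)

lemma chart_inv_cmap [simp]:
  "smooth_manifold M \<Longrightarrow> x \<in> topspace (mtop M) \<Longrightarrow> z \<in> cdom M x \<Longrightarrow> chart_inv M x (cmap M x z) = z"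
  unfolding chart_inv_def by (simp add: inj_on_cmap)

text \<open>A chart is a homeomorphism onto an open set. This supplies the neighbourhoods on which
  two coordinate expressions agree, as needed to transfer derivatives.\<close>

lemma open_cmap_image:
  assumes "smooth_manifold M" "x \<in> topspace (mtop M)" "openin (mtop M) W" "W \<subseteq> cdom M x"
  shows "open (cmap M x ` W)"
proof -
  have "openin (subtopology (mtop M) (cdom M x)) W"
    using assms by (simp add: openin_open_subtopology openin_cdom)
  then have "openin (top_of_set (cmap M x ` cdom M x)) (cmap M x ` W)"
    using homeomorphic_imp_open_map[OF homeomorphic_map_cmap[OF assms(1,2)]]
    unfolding open_map_def by blast
  then show ?thesis using open_chart_range[OF assms(1,2)] openin_open_trans by blast
qed

lemma openin_cmap_preimage:
  assumes "smooth_manifold M" "x \<in> topspace (mtop M)" "open T"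
  shows "openin (mtop M) {z \<in> cdom M x. cmap M x z \<in> T}"
proof -
  have "openin (subtopology (mtop M) (cdom M x))
      {z \<in> topspace (subtopology (mtop M) (cdom M x)). cmap M x z \<in> cmap M x ` cdom M x \<inter> T}"
    by (rule openin_continuous_map_preimage[OF
          homeomorphic_imp_continuous_map[OF homeomorphic_map_cmap[OF assms(1,2)]]])
       (use assms(3) in \<open>auto simp: openin_open\<close>)
  moreover have "{z \<in> topspace (subtopology (mtop M) (cdom M x)). cmap M x z \<in> cmap M x ` cdom M x \<inter> T}
      = {z \<in> cdom M x. cmap M x z \<in> T}"
    using cdom_subset_topspace[OF assms(1,2)] by auto
  ultimately show ?thesis
    using openin_open_subtopology[OF openin_cdom[OF assms(1,2)]] by auto
qed

lemma has_derivative_Blinfun: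
  "F differentiable (at x) \<Longrightarrow>
    (F has_derivative blinfun_apply (Blinfun (frechet_derivative F (at x)))) (at x)"
  by (metis bounded_linear_Blinfun_apply frechet_derivative_works has_derivative_bounded_linear)

lemma has_derivative_blinfun_unique:
  "(F has_derivative blinfun_apply A) (at x) \<Longrightarrow> (F has_derivative blinfun_apply B) (at x) \<Longrightarrow> A = B"
  by (metis blinfun_apply_inject has_derivative_unique)

lemma chart_trans_has_derivative:
  assumes "smooth_manifold M" "x \<in> topspace (mtop M)" "y \<in> topspace (mtop M)"
    and "z \<in> cdom M x" "z \<in> cdom M y"
  shows "(cmap M y \<circ> chart_inv M x has_derivative chart_trans M x y z) (at (cmap M x z))"
  unfolding chart_trans_def
proof (rule has_derivative_Blinfun, rule smooth_on_differentiable(1))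
  show "smooth_on (cmap M x ` (cdom M x \<inter> cdom M y)) (cmap M y \<circ> chart_inv M x)"
    using assms unfolding smooth_manifold_def by blast
qed (use assms in auto)

text \<open>Cocycle rule, by the chain rule. The composed coordinate changes reduce to a single one
  only over the overlap of the first two chart domains, hence the open set
  \<open>?W\<close>.\<close>

lemma chart_trans_compose:
  assumes M: "smooth_manifold M" and x: "x \<in> topspace (mtop M)" "z \<in> cdom M x"
    and y: "y \<in> topspace (mtop M)" "z \<in> cdom M y" and u: "u \<in> topspace (mtop M)" "z \<in> cdom M u"
  shows "chart_trans M y u z o\<^sub>L chart_trans M x y z = chart_trans M x u z"
proof (rule has_derivative_blinfun_unique)
  let ?W = "cmap M x ` (cdom M x \<inter> cdom M y)"
  have "((cmap M u \<circ> chart_inv M y) \<circ> (cmap M y \<circ> chart_inv M x) has_derivative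
      chart_trans M y u z \<circ> chart_trans M x y z) (at (cmap M x z))"
    by (rule diff_chain_at) (use assms in \<open>auto intro!: chart_trans_has_derivative\<close>)
  then show "(cmap M u \<circ> chart_inv M x has_derivative
      chart_trans M y u z o\<^sub>L chart_trans M x y z) (at (cmap M x z))"
    unfolding blinfun_compose.rep_eq
  proof (rule has_derivative_transform_within_open[where s = ?W])
    show "open ?W" by (rule open_cmap_image) (use assms in \<open>auto intro!: openin_Int openin_cdom\<close>)
  qed (use assms in auto)
qed (rule chart_trans_has_derivative[OF M x(1) u(1) x(2) u(2)])

lemma chart_trans_self:
  assumes M: "smooth_manifold M" and x: "x \<in> topspace (mtop M)" "z \<in> cdom M x"
  shows "chart_trans M x x z = id_blinfun"
proof (rule has_derivative_blinfun_unique)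
  have "((\<lambda>y. y) has_derivative id_blinfun) (at (cmap M x z))" by simp
  then show "(cmap M x \<circ> chart_inv M x has_derivative id_blinfun) (at (cmap M x z))"
    by (rule has_derivative_transform_within_open[OF _ open_chart_range[OF M x(1)]])
       (use assms in auto)
qed (rule chart_trans_has_derivative[OF M x(1) x(1) x(2) x(2)])

section \<open>Differentiable maps between manifolds\<close>

text \<open>Continuity is required globally, so that preimages of chart domains are open;
  differentiability is required only at \<open>x\<close>, in the preferred charts at
  \<open>x\<close> and \<open>F x\<close>.\<close>

definition mdifferentiable_at ::
  "('a, 'e::euclidean_space) manifold \<Rightarrow> ('b, 'f::euclidean_space) manifold
    \<Rightarrow> ('a \<Rightarrow> 'b) \<Rightarrow> 'a \<Rightarrow> bool" where
  "mdifferentiable_at M N F x \<longleftrightarrow>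
     x \<in> topspace (mtop M) \<and> continuous_map (mtop M) (mtop N) F \<and>
     (cmap N (F x) \<circ> F \<circ> chart_inv M x) differentiable (at (cmap M x x))"

lemma mdifferentiable_atD:
  assumes "mdifferentiable_at M N F x"
  shows "x \<in> topspace (mtop M)" "F x \<in> topspace (mtop N)" "continuous_map (mtop M) (mtop N) F"
  using assms unfolding mdifferentiable_at_def by (auto dest: continuous_map_image_subset_topspace)

lemma smooth_map_imp_mdifferentiable_at:
  assumes "smooth_manifold M" "smooth_manifold N" "smooth_map M N F" "x \<in> topspace (mtop M)"
  shows "mdifferentiable_at M N F x"
proof -
  have c: "continuous_map (mtop M) (mtop N) F"
    using assms(3) unfolding smooth_map_on_def by simp
  then have Fx: "F x \<in> topspace (mtop N)"
    using assms(4) continuous_map_image_subset_topspace by blast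
  have "smooth_on (cmap M x ` (topspace (mtop M) \<inter> cdom M x \<inter> F -` cdom N (F x)))
      (cmap N (F x) \<circ> F \<circ> chart_inv M x)"
    using assms(3,4) Fx unfolding smooth_map_on_def by blast
  then have "(cmap N (F x) \<circ> F \<circ> chart_inv M x) differentiable (at (cmap M x x))"
    by (rule smooth_on_differentiable) (use assms(4) mem_cdom[OF assms(1,4)] mem_cdom[OF assms(2) Fx] in blast)
  then show ?thesis using c assms(4) unfolding mdifferentiable_at_def by blast
qed

lemma openin_chart_preimage:
  assumes "smooth_manifold M" "continuous_map (mtop M) (mtop N) F"
    and "a \<in> topspace (mtop M)" "openin (mtop N) T"
  shows "openin (mtop M) {z \<in> cdom M a. F z \<in> T}"
  by (rule openin_continuous_map_preimage_gen[OF assms(2) openin_cdom[OF assms(1,3)] assms(4)])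

lemma mderiv_has_derivative:
  assumes "mdifferentiable_at M N F x"
  shows "(cmap N (F x) \<circ> F \<circ> chart_inv M x has_derivative mderiv M N F x) (at (cmap M x x))"
  using assms unfolding mdifferentiable_at_def mderiv_def by (intro has_derivative_Blinfun) simp

lemma mderiv_in_charts:
  assumes M: "smooth_manifold M" and N: "smooth_manifold N" and F: "mdifferentiable_at M N F x"
    and a: "a \<in> topspace (mtop M)" "x \<in> cdom M a"
    and b: "b \<in> topspace (mtop N)" "F x \<in> cdom N b"
  shows "(cmap N b \<circ> F \<circ> chart_inv M a has_derivative
      chart_trans N (F x) b (F x) o\<^sub>L mderiv M N F x o\<^sub>L chart_trans M a x x) (at (cmap M a x))"
proof -
  note F' = mdifferentiable_atD[OF F]
  have xx: "x \<in> cdom M x" "F x \<in> cdom N (F x)" using M N F' by (auto intro!: mem_cdom)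
  let ?W = "{z \<in> cdom M a. F z \<in> cdom N (F x)} \<inter> cdom M x"
  have "((cmap N b \<circ> chart_inv N (F x)) \<circ> ((cmap N (F x) \<circ> F \<circ> chart_inv M x) \<circ> (cmap M x \<circ> chart_inv M a))
      has_derivative chart_trans N (F x) b (F x) \<circ> (mderiv M N F x \<circ> chart_trans M a x x)) (at (cmap M a x))"
  proof (intro diff_chain_at)
    show "(cmap M x \<circ> chart_inv M a has_derivative chart_trans M a x x) (at (cmap M a x))"
      by (rule chart_trans_has_derivative[OF M a(1) F'(1) a(2) xx(1)])
    show "(cmap N (F x) \<circ> F \<circ> chart_inv M x has_derivative mderiv M N F x)
        (at ((cmap M x \<circ> chart_inv M a) (cmap M a x)))"
      using mderiv_has_derivative[OF F] M a by simp
    show "(cmap N b \<circ> chart_inv N (F x) has_derivative chart_trans N (F x) b (F x))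
        (at ((cmap N (F x) \<circ> F \<circ> chart_inv M x \<circ> (cmap M x \<circ> chart_inv M a)) (cmap M a x)))"
      using chart_trans_has_derivative[OF N F'(2) b(1) xx(2) b(2)] M a F' xx by simp
  qed
  then have "(cmap N b \<circ> F \<circ> chart_inv M a has_derivative
      chart_trans N (F x) b (F x) \<circ> (mderiv M N F x \<circ> chart_trans M a x x)) (at (cmap M a x))"
  proof (rule has_derivative_transform_within_open)
    show "open (cmap M a ` ?W)"
      by (rule open_cmap_image)
         (use M N a F' openin_chart_preimage[OF M F'(3) a(1) openin_cdom[OF N F'(2)]]
 in \<open>auto intro!: openin_Int openin_cdom\<close>)
    show "cmap M a x \<in> cmap M a ` ?W" using a xx by auto
  qed (use M N a F' in auto)
  then show ?thesis by (simp add: blinfun_compose.rep_eq comp_assoc)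
qed

lemma mderiv_eqI:
  assumes "(cmap N (F x) \<circ> F \<circ> chart_inv M x has_derivative blinfun_apply D) (at (cmap M x x))"
  shows "mderiv M N F x = D"
  using assms unfolding mderiv_def by (metis blinfun_apply_inverse frechet_derivative_at)

text \<open>The preferred chart at \<open>F x\<close> is both the target chart of \<open>F\<close>
  and the source chart of \<open>F2\<close>, so the chain rule involves no transition
  derivative.\<close>

lemma mdifferentiable_at_compose:
  assumes M: "smooth_manifold M" and N: "smooth_manifold N"
    and F: "mdifferentiable_at M N F x" and F2: "mdifferentiable_at N P F2 (F x)"
  shows "mdifferentiable_at M P (F2 \<circ> F) x"
    and "mderiv M P (F2 \<circ> F) x = mderiv N P F2 (F x) o\<^sub>L mderiv M N F x"
proof -
  note F' = mdifferentiable_atD[OF F]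
  have xx: "x \<in> cdom M x" "F x \<in> cdom N (F x)" using M N F' by (auto intro!: mem_cdom)
  let ?W = "{z \<in> cdom M x. F z \<in> cdom N (F x)}"
  have "((cmap P (F2 (F x)) \<circ> F2 \<circ> chart_inv N (F x)) \<circ> (cmap N (F x) \<circ> F \<circ> chart_inv M x)
      has_derivative mderiv N P F2 (F x) \<circ> mderiv M N F x) (at (cmap M x x))"
    using mderiv_has_derivative[OF F] mderiv_has_derivative[OF F2] M F' xx
    by (intro diff_chain_at) auto
  then have D: "(cmap P ((F2 \<circ> F) x) \<circ> (F2 \<circ> F) \<circ> chart_inv M x has_derivative
      mderiv N P F2 (F x) o\<^sub>L mderiv M N F x) (at (cmap M x x))"
    unfolding blinfun_compose.rep_eq
  proof (rule has_derivative_transform_within_open)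
    show "open (cmap M x ` ?W)"
      by (rule open_cmap_image)
         (use M F' openin_chart_preimage[OF M F'(3) F'(1) openin_cdom[OF N F'(2)]] in auto)
    show "cmap M x x \<in> cmap M x ` ?W" using xx by auto
  qed (use M N F' in auto)
  then show "mderiv M P (F2 \<circ> F) x = mderiv N P F2 (F x) o\<^sub>L mderiv M N F x"
    by (rule mderiv_eqI)
  show "mdifferentiable_at M P (F2 \<circ> F) x"
    using D F' mdifferentiable_atD(3)[OF F2] unfolding mdifferentiable_at_def differentiable_def
    by (auto intro: continuous_map_compose)
qed

lemma mderiv_cong:
  assumes M: "smooth_manifold M" and F: "mdifferentiable_at M N F x"
    and eq: "\<And>z. z \<in> topspace (mtop M) \<Longrightarrow> F z = F2 z"
  shows "mderiv M N F2 x = mderiv M N F x"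
proof (rule mderiv_eqI)
  note F' = mdifferentiable_atD[OF F]
  have "F2 x = F x" using eq F' by simp
  then show "(cmap N (F2 x) \<circ> F2 \<circ> chart_inv M x has_derivative mderiv M N F x) (at (cmap M x x))"
    using has_derivative_transform_within_open[OF mderiv_has_derivative[OF F]
        open_chart_range[OF M F'(1)], of "cmap N (F2 x) \<circ> F2 \<circ> chart_inv M x"]
      M F' mem_cdom[OF M] cdom_subset_topspace[OF M F'(1)] eq by fastforce
qed

lemma has_velocity_compose:
  assumes M: "smooth_manifold M" and N: "smooth_manifold N"
    and F: "mdifferentiable_at M N F (c t)" and c: "has_velocity M c v t"
  shows "has_velocity N (\<lambda>s. F (c s)) (mderiv M N F (c t) v) t"
proof -
  let ?a = "c t"
  note F' = mdifferentiable_atD[OF F]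
  have xx: "?a \<in> cdom M ?a" "F ?a \<in> cdom N (F ?a)" using M N F' by (auto intro!: mem_cdom)
  let ?W = "{z \<in> cdom M ?a. F z \<in> cdom N (F ?a)}"
  have ev: "\<forall>\<^sub>F s in nhds t. c s \<in> cdom M ?a"
    and der: "((\<lambda>s. cmap M ?a (c s)) has_derivative (\<lambda>w. w *\<^sub>R v)) (at t)"
    using c unfolding has_velocity_def has_vector_derivative_def by auto
  have W: "open (cmap M ?a ` ?W)"
    by (rule open_cmap_image)
       (use M F' openin_chart_preimage[OF M F'(3) F'(1) openin_cdom[OF N F'(2)]] in auto)
  have "isCont (\<lambda>s. cmap M ?a (c s)) t"
    using der by (rule has_derivative_continuous)
  then have "\<forall>\<^sub>F s in at t. cmap M ?a (c s) \<in> cmap M ?a ` ?W"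
    using xx by (intro topological_tendstoD[OF _ W]) (auto simp: isCont_def)
  then have "\<forall>\<^sub>F s in nhds t. cmap M ?a (c s) \<in> cmap M ?a ` ?W"
    using xx by (auto simp: eventually_nhds_conv_at)
  \<comment> \<open>The velocity controls only the coordinates of the curve; injectivity of the
    chart on its domain brings the curve itself back into \<open>?W\<close>.\<close>
  with ev have ev2: "\<forall>\<^sub>F s in nhds t. c s \<in> ?W"
  proof eventually_elim
    case (elim s)
    then show ?case using inj_onD[OF inj_on_cmap[OF M F'(1)]] by auto
  qed
  then have 1: "\<forall>\<^sub>F s in nhds t. F (c s) \<in> cdom N (F ?a)" by eventually_elim auto
  have "((cmap N (F ?a) \<circ> F \<circ> chart_inv M ?a) \<circ> (\<lambda>s. cmap M ?a (c s)) has_derivative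
      mderiv M N F ?a \<circ> (\<lambda>w. w *\<^sub>R v)) (at t)"
    by (rule diff_chain_at[OF der mderiv_has_derivative[OF F]])
  then have "((\<lambda>s. cmap N (F ?a) (F (c s))) has_derivative mderiv M N F ?a \<circ> (\<lambda>w. w *\<^sub>R v)) (at t)"
  proof (rule has_derivative_transform_eventually)
    show "\<forall>\<^sub>F s in at t. ((cmap N (F ?a) \<circ> F \<circ> chart_inv M ?a) \<circ> (\<lambda>s. cmap M ?a (c s))) s
        = cmap N (F ?a) (F (c s))"
      using ev2[unfolded eventually_nhds_conv_at, THEN conjunct1]
      by eventually_elim (use M F' in auto)
  qed (use M F' xx in auto)
  then have 2: "((\<lambda>s. cmap N (F ?a) (F (c s))) has_vector_derivative mderiv M N F ?a v) (at t)"
    unfolding has_vector_derivative_def by (simp add: o_def blinfun.scaleR_right)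
  show ?thesis using 1 2 unfolding has_velocity_def by blast
qed

lemma prod_chart_inv:
  assumes "smooth_manifold M" "smooth_manifold N"
    and "a \<in> topspace (mtop M)" "b \<in> topspace (mtop N)" "x \<in> cdom M a" "y \<in> cdom N b"
  shows "chart_inv (prod_manifold M N) (a, b) (cmap M a x, cmap N b y) = (x, y)"
proof -
  have "inj_on (\<lambda>(x, y). (cmap M a x, cmap N b y)) (cdom M a \<times> cdom N b)"
    using inj_on_cmap[OF assms(1,3)] inj_on_cmap[OF assms(2,4)] by (auto simp: inj_on_def)
  then show ?thesis
    unfolding chart_inv_def prod_manifold_def using assms(5,6)
    by (auto intro!: inv_into_f_eq)
qed

lemma id_blinfun_compose [simp]: "id_blinfun o\<^sub>L A = A" "A o\<^sub>L id_blinfun = A"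
  by (auto intro: blinfun_eqI)

lemma differentiable_transform_open:
  assumes "f differentiable (at x)" "open S" "x \<in> S" "\<And>y. y \<in> S \<Longrightarrow> f y = g y"
  shows "g differentiable (at x)"
  using assms has_derivative_transform_within_open unfolding differentiable_def by metis

section \<open>Translations on a Lie group\<close>

lemma lie_groupD:
  assumes "lie_group G M"
  shows "group G" "smooth_manifold M" "topspace (mtop M) = carrier G"
  using assms unfolding lie_group_def by auto

text \<open>The charts at \<open>g\<close> and \<open>h\<close> are used for the factors, the one at \<open>b\<close> for the product.\<close>

definition mult_rep ::
  "'a monoid \<Rightarrow> ('a, 'e::euclidean_space) manifold \<Rightarrow> 'a \<Rightarrow> 'a \<Rightarrow> 'a \<Rightarrow> 'e \<times> 'e \<Rightarrow> 'e" where
  "mult_rep G M g h b = cmap M b \<circ> (\<lambda>(x, y). x \<otimes>\<^bsub>G\<^esub> y) \<circ> chart_inv (prod_manifold M M) (g, h)"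

text \<open>The map \<open>A(x)\<close> of the introduction, with values expressed in the chart at \<open>a\<close>.\<close>

definition left_triv ::
  "'a monoid \<Rightarrow> ('a, 'e::euclidean_space) manifold \<Rightarrow> 'a \<Rightarrow> 'e \<Rightarrow> 'e \<Rightarrow>\<^sub>L 'e" where
  "left_triv G M a x =
     (let z = chart_inv M a x in chart_trans M z a z o\<^sub>L mderiv M M (lmult G z) \<one>\<^bsub>G\<^esub>)"

locale lie_group_manifold =
  fixes G :: "'g monoid" (structure) and M :: "('g, 'e::euclidean_space) manifold"
  assumes lie: "lie_group G M"

sublocale lie_group_manifold \<subseteq> group G
  using lie by (rule lie_groupD)

context lie_group_manifold
begin

lemmas smooth = lie_groupD(2)[OF lie]
lemmas topspace_carrier [simp] = lie_groupD(3)[OF lie]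

lemma mem_cdom_carrier: "g \<in> carrier G \<Longrightarrow> g \<in> cdom M g"
  using mem_cdom[OF smooth] by simp

lemma cdom_carrier: "a \<in> carrier G \<Longrightarrow> z \<in> cdom M a \<Longrightarrow> z \<in> carrier G"
  using cdom_subset_topspace[OF smooth, of a] by auto

lemma mult_rep_apply:
  assumes "g \<in> carrier G" "h \<in> carrier G" "x \<in> cdom M g" "y \<in> cdom M h"
  shows "mult_rep G M g h b (cmap M g x, cmap M h y) = cmap M b (x \<otimes>\<^bsub>G\<^esub> y)"
  using assms prod_chart_inv[OF smooth smooth, of g h x y] by (simp add: mult_rep_def)

text \<open>Joint smoothness of multiplication, used up to second order. The regularity of
  translations and of their derivatives below is obtained from it by freezing one variable.\<close>

lemma mult_rep_differentiable:
  assumes "g \<in> carrier G" "h \<in> carrier G" "b \<in> carrier G"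
    and "x \<in> cdom M g" "y \<in> cdom M h" "x \<otimes>\<^bsub>G\<^esub> y \<in> cdom M b"
  shows "mult_rep G M g h b differentiable (at (cmap M g x, cmap M h y))"
    and "(\<lambda>z. frechet_derivative (mult_rep G M g h b) (at z) v) differentiable (at (cmap M g x, cmap M h y))"
proof -
  let ?P = "prod_manifold M M"
  let ?S = "cmap ?P (g, h) ` (topspace (mtop ?P) \<inter> cdom ?P (g, h) \<inter> (\<lambda>(x, y). x \<otimes>\<^bsub>G\<^esub> y) -` cdom M b)"
  have "smooth_map ?P M (\<lambda>(x, y). x \<otimes>\<^bsub>G\<^esub> y)" using lie unfolding lie_group_def by blast
  moreover have "(g, h) \<in> topspace (mtop ?P)" "b \<in> topspace (mtop M)"
    using assms by (auto simp: prod_manifold_def)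
  ultimately have sm': "smooth_on ?S (mult_rep G M g h b)"
    unfolding smooth_map_on_def mult_rep_def by blast
  have "(x, y) \<in> topspace (mtop ?P) \<inter> cdom ?P (g, h) \<inter> (\<lambda>(x, y). x \<otimes>\<^bsub>G\<^esub> y) -` cdom M b"
    using assms cdom_carrier by (auto simp: prod_manifold_def)
  moreover have "cmap ?P (g, h) (x, y) = (cmap M g x, cmap M h y)" by (simp add: prod_manifold_def)
  ultimately have "(cmap M g x, cmap M h y) \<in> ?S" by (metis (no_types, lifting) imageI)
  then show "mult_rep G M g h b differentiable (at (cmap M g x, cmap M h y))"
    and "(\<lambda>z. frechet_derivative (mult_rep G M g h b) (at z) v) differentiable (at (cmap M g x, cmap M h y))"
    using smooth_on_differentiable[OF sm'] by auto
qed

lemma continuous_map_mult: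
  assumes "continuous_map X (mtop M) a" "continuous_map X (mtop M) b"
  shows "continuous_map X (mtop M) (\<lambda>y. a y \<otimes>\<^bsub>G\<^esub> b y)"
proof -
  have "continuous_map (prod_topology (mtop M) (mtop M)) (mtop M) (\<lambda>(x, y). x \<otimes>\<^bsub>G\<^esub> y)"
    using lie unfolding lie_group_def smooth_map_on_def subtopology_topspace
    by (simp add: prod_manifold_def del: topspace_carrier)
  from continuous_map_compose[OF continuous_map_pairedI[OF assms] this]
  show ?thesis by (simp add: o_def)
qed

lemma lmult_mdifferentiable:
  assumes "g \<in> carrier G" "h \<in> carrier G"
  shows "mdifferentiable_at M M (lmult G g) h"
  unfolding mdifferentiable_at_def
proof (intro conjI)
  show "continuous_map (mtop M) (mtop M) (lmult G g)"
    unfolding lmult_def using assms by (intro continuous_map_mult) auto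
  let ?b = "lmult G g h"
  have b: "?b = g \<otimes> h" "?b \<in> carrier G" using assms by (auto simp: lmult_def)
  have "mult_rep G M g h ?b differentiable (at (cmap M g g, cmap M h h))"
    using assms b by (intro mult_rep_differentiable) (auto intro!: mem_cdom_carrier)
  then have "(mult_rep G M g h ?b \<circ> Pair (cmap M g g)) differentiable (at (cmap M h h))"
    by (intro differentiable_chain_at) (auto intro!: derivative_intros)
  then show "(cmap M ?b \<circ> lmult G g \<circ> chart_inv M h) differentiable (at (cmap M h h))"
  proof (rule differentiable_transform_open)
    show "open (cmap M h ` cdom M h)" using open_chart_range[OF smooth] assms by simp
  qed (use assms smooth mem_cdom_carrier in \<open>auto simp: mult_rep_apply lmult_def\<close>)
qed (use assms in simp)

lemma rmult_mdifferentiable: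
  assumes "g \<in> carrier G" "h \<in> carrier G"
  shows "mdifferentiable_at M M (rmult G g) h"
  unfolding mdifferentiable_at_def
proof (intro conjI)
  show "continuous_map (mtop M) (mtop M) (rmult G g)"
    unfolding rmult_def using assms by (intro continuous_map_mult) auto
  let ?b = "rmult G g h"
  have b: "?b = h \<otimes> g" "?b \<in> carrier G" using assms by (auto simp: rmult_def)
  have "mult_rep G M h g ?b differentiable (at (cmap M h h, cmap M g g))"
    using assms b by (intro mult_rep_differentiable) (auto intro!: mem_cdom_carrier)
  then have "(mult_rep G M h g ?b \<circ> (\<lambda>y. (y, cmap M g g))) differentiable (at (cmap M h h))"
    by (intro differentiable_chain_at) (auto intro!: derivative_intros)
  then show "(cmap M ?b \<circ> rmult G g \<circ> chart_inv M h) differentiable (at (cmap M h h))"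
  proof (rule differentiable_transform_open)
    show "open (cmap M h ` cdom M h)" using open_chart_range[OF smooth] assms by simp
  qed (use assms smooth mem_cdom_carrier in \<open>auto simp: mult_rep_apply rmult_def\<close>)
qed (use assms in simp)

text \<open>Associativity factors the translation by \<open>g \<otimes> h\<close> on the carrier,
  and the chain rule does the rest.\<close>

lemma mderiv_lmult_mult:
  assumes "g \<in> carrier G" "h \<in> carrier G"
  shows "mderiv M M (lmult G (g \<otimes> h)) \<one> = mderiv M M (lmult G g) h o\<^sub>L mderiv M M (lmult G h) \<one>"
proof -
  have h: "lmult G h \<one> = h" using assms by (simp add: lmult_def)
  have d: "mdifferentiable_at M M (lmult G h) \<one>" "mdifferentiable_at M M (lmult G g) (lmult G h \<one>)"
    unfolding h using assms by (auto intro: lmult_mdifferentiable)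
  have "mderiv M M (lmult G (g \<otimes> h)) \<one> = mderiv M M (lmult G g \<circ> lmult G h) \<one>"
    by (rule mderiv_cong[OF smooth mdifferentiable_at_compose(1)[OF smooth smooth d]])
       (use assms in \<open>auto simp: lmult_def m_assoc\<close>)
  then show ?thesis using mdifferentiable_at_compose(2)[OF smooth smooth d] h by simp
qed

lemma mderiv_lmult_one: "mderiv M M (lmult G \<one>) \<one> = id_blinfun"
proof (rule mderiv_eqI)
  have "((\<lambda>y. y) has_derivative id_blinfun) (at (cmap M \<one> \<one>))" by simp
  then show "(cmap M (lmult G \<one> \<one>) \<circ> lmult G \<one> \<circ> chart_inv M \<one> has_derivative id_blinfun)
      (at (cmap M \<one> \<one>))"
  proof (rule has_derivative_transform_within_open)
    show "open (cmap M \<one> ` cdom M \<one>)" using open_chart_range[OF smooth] by simp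
  qed (use smooth mem_cdom_carrier cdom_carrier[OF one_closed] in \<open>auto simp: lmult_def\<close>)
qed

lemma left_triv_self:
  assumes "a \<in> carrier G"
  shows "left_triv G M a (cmap M a a) = mderiv M M (lmult G a) \<one>"
  unfolding left_triv_def Let_def
  using assms smooth by (simp add: mem_cdom_carrier chart_trans_self)

text \<open>Both sides differentiate the product of \<open>z\<close> with a variable point at the
  identity. As a partial derivative of multiplication, \<open>left_triv\<close> becomes visibly
  regular in its base point; the chart at \<open>a\<close> serves the first factor and the product
  alike, since \<open>z \<otimes> \<one> = z\<close>.\<close>

lemma left_triv_eq:
  assumes a: "a \<in> carrier G" and z: "z \<in> cdom M a"
  shows "left_triv G M a (cmap M a z) v =
    frechet_derivative (mult_rep G M a \<one> a) (at (cmap M a z, cmap M \<one> \<one>)) (0, v)"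
proof -
  have zc: "z \<in> carrier G" using a z cdom_carrier by blast
  let ?R = "mult_rep G M a \<one> a" and ?y = "cmap M \<one> \<one>" and ?x = "cmap M a z"
  let ?D = "frechet_derivative ?R (at (?x, ?y))"
  have z1: "lmult G z \<one> = z" using zc by (simp add: lmult_def)
  have "(cmap M a \<circ> lmult G z \<circ> chart_inv M \<one> has_derivative
      chart_trans M z a z o\<^sub>L mderiv M M (lmult G z) \<one> o\<^sub>L chart_trans M \<one> \<one> \<one>) (at ?y)"
    using mderiv_in_charts[OF smooth smooth lmult_mdifferentiable[OF zc one_closed], of \<one> a] a z
    by (simp add: z1 mem_cdom_carrier)
  moreover have "chart_trans M \<one> \<one> \<one> = id_blinfun"
    by (rule chart_trans_self[OF smooth]) (auto intro: mem_cdom_carrier)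
  ultimately have 1: "(cmap M a \<circ> lmult G z \<circ> chart_inv M \<one> has_derivative left_triv G M a ?x) (at ?y)"
    using a z smooth by (simp add: left_triv_def Let_def blinfun_compose.rep_eq o_def)
  have "?R differentiable (at (?x, ?y))"
    by (rule mult_rep_differentiable) (use a z zc mem_cdom_carrier in auto)
  then have "(?R has_derivative ?D) (at (?x, ?y))" using frechet_derivative_works by blast
  then have "((\<lambda>y. ?R (?x, y)) has_derivative (\<lambda>v. ?D (0, v))) (at ?y)"
    by (rule has_derivative_compose[where f = "Pair ?x" and g = ?R, rotated])
       (auto intro!: derivative_eq_intros)
  then have 2: "(cmap M a \<circ> lmult G z \<circ> chart_inv M \<one> has_derivative (\<lambda>v. ?D (0, v))) (at ?y)"
  proof (rule has_derivative_transform_within_open)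
    show "open (cmap M \<one> ` cdom M \<one>)" using open_chart_range[OF smooth] by simp
  qed (use a z smooth mem_cdom_carrier in \<open>auto simp: mult_rep_apply lmult_def\<close>)
  show ?thesis using has_derivative_unique[OF 1 2] by metis
qed

text \<open>By \<open>left_triv_eq\<close> this is a second derivative of multiplication, restricted
  to the slice where the second factor is the identity.\<close>

lemma left_triv_differentiable:
  assumes a: "a \<in> carrier G" and z: "z \<in> cdom M a"
  shows "left_triv G M a differentiable (at (cmap M a z))"
proof (rule differentiable_blinfun_componentwise)
  fix v
  have zc: "z \<in> carrier G" using a z cdom_carrier by blast
  let ?R = "mult_rep G M a \<one> a" and ?y = "cmap M \<one> \<one>"
  have "(\<lambda>w. frechet_derivative ?R (at w) (0, v)) differentiable (at (cmap M a z, ?y))"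
    by (rule mult_rep_differentiable) (use a z zc mem_cdom_carrier in auto)
  then have "((\<lambda>w. frechet_derivative ?R (at w) (0, v)) \<circ> (\<lambda>x. (x, ?y))) differentiable (at (cmap M a z))"
    by (intro differentiable_chain_at) (auto intro!: derivative_intros)
  then show "(\<lambda>x. left_triv G M a x v) differentiable (at (cmap M a z))"
  proof (rule differentiable_transform_open)
    show "open (cmap M a ` cdom M a)" using open_chart_range[OF smooth] a by simp
  qed (use a z left_triv_eq in auto)
qed

section \<open>Left translation in charts and the bracket of left-invariant fields\<close>

definition lmult_rep :: "'g \<Rightarrow> 'e \<Rightarrow> 'e" where
  "lmult_rep a = cmap M a \<circ> lmult G a \<circ> chart_inv M \<one>"

text \<open>An explicit operator-valued formula for the derivative of \<open>lmult_rep a\<close>,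
  meaningful at points \<open>z\<close> with \<open>a \<otimes> z\<close> in the chart domain at
  \<open>a\<close>. Its last factor is chosen to cancel against the transition in
  \<open>left_triv\<close>.\<close>

definition lmult_rep_deriv :: "'g \<Rightarrow> 'e \<Rightarrow> 'e \<Rightarrow>\<^sub>L 'e" where
  "lmult_rep_deriv a x = (let z = chart_inv M \<one> x in
     chart_trans M (a \<otimes> z) a (a \<otimes> z) o\<^sub>L mderiv M M (lmult G a) z o\<^sub>L chart_trans M \<one> z z)"

lemma lmult_rep_has_derivative:
  assumes a: "a \<in> carrier G" and z: "z \<in> cdom M \<one>" "a \<otimes> z \<in> cdom M a"
  shows "(lmult_rep a has_derivative lmult_rep_deriv a (cmap M \<one> z)) (at (cmap M \<one> z))"
proof -
  have zc: "z \<in> carrier G" using z cdom_carrier[OF one_closed] by blast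
  show ?thesis
    using mderiv_in_charts[OF smooth smooth lmult_mdifferentiable[OF a zc], of \<one> a] a z smooth
    by (simp add: lmult_rep_def lmult_rep_deriv_def Let_def lmult_def)
qed

lemma open_lmult_rep_domain:
  assumes "a \<in> carrier G"
  shows "open (cmap M \<one> ` {z \<in> cdom M \<one>. a \<otimes> z \<in> cdom M a})"
proof (rule open_cmap_image[OF smooth])
  show "openin (mtop M) {z \<in> cdom M \<one>. a \<otimes> z \<in> cdom M a}"
    using openin_chart_preimage[OF smooth mdifferentiable_atD(3)[OF lmult_mdifferentiable[OF assms one_closed]],
        of \<one> "cdom M a"] openin_cdom[OF smooth, of a] assms
    by (simp add: lmult_def)
qed auto

text \<open>Near the identity the formula is again the partial derivative of multiplication in the
  second factor, now with the first factor frozen at \<open>a\<close> and the second one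
  moving.\<close>

lemma lmult_rep_deriv_differentiable:
  assumes a: "a \<in> carrier G"
  shows "lmult_rep_deriv a differentiable (at (cmap M \<one> \<one>))"
proof (rule differentiable_blinfun_componentwise)
  fix v
  let ?R = "mult_rep G M a \<one> a" and ?y = "cmap M \<one> \<one>" and ?x = "cmap M a a"
  let ?W = "{z \<in> cdom M \<one>. a \<otimes> z \<in> cdom M a}"
  have "lmult_rep_deriv a (cmap M \<one> z) v = frechet_derivative ?R (at (?x, cmap M \<one> z)) (0, v)"
    if z: "z \<in> ?W" for z
  proof -
    let ?D = "frechet_derivative ?R (at (?x, cmap M \<one> z))"
    have "?R differentiable (at (?x, cmap M \<one> z))"
      by (rule mult_rep_differentiable) (use a z mem_cdom_carrier in auto)
    then have "(?R has_derivative ?D) (at (?x, cmap M \<one> z))" using frechet_derivative_works by blast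
    then have "((\<lambda>y. ?R (?x, y)) has_derivative (\<lambda>v. ?D (0, v))) (at (cmap M \<one> z))"
      by (rule has_derivative_compose[where f = "Pair ?x" and g = ?R, rotated])
         (auto intro!: derivative_eq_intros)
    then have 2: "(lmult_rep a has_derivative (\<lambda>v. ?D (0, v))) (at (cmap M \<one> z))"
    proof (rule has_derivative_transform_within_open)
      show "open (cmap M \<one> ` cdom M \<one>)" using open_chart_range[OF smooth] by simp
    qed (use a z smooth mem_cdom_carrier in \<open>auto simp: mult_rep_apply lmult_rep_def lmult_def\<close>)
    have "(lmult_rep a has_derivative lmult_rep_deriv a (cmap M \<one> z)) (at (cmap M \<one> z))"
      using lmult_rep_has_derivative a z by blast
    from has_derivative_unique[OF this 2] show ?thesis by metis
  qed
  then have eq: "frechet_derivative ?R (at (?x, y)) (0, v) = lmult_rep_deriv a y v"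
    if "y \<in> cmap M \<one> ` ?W" for y using that by auto
  have "(\<lambda>w. frechet_derivative ?R (at w) (0, v)) differentiable (at (?x, ?y))"
    by (rule mult_rep_differentiable) (use a mem_cdom_carrier in auto)
  then have "((\<lambda>w. frechet_derivative ?R (at w) (0, v)) \<circ> Pair ?x) differentiable (at ?y)"
    by (intro differentiable_chain_at) (auto intro!: derivative_intros)
  then show "(\<lambda>x. lmult_rep_deriv a x v) differentiable (at ?y)"
    by (rule differentiable_transform_open[OF _ open_lmult_rep_domain[OF a]])
       (use a eq mem_cdom_carrier in auto)
qed

text \<open>Left-invariant fields are preserved by left translation. This is
  \<open>mderiv_lmult_mult\<close> in charts: the transitions between the charts at
  \<open>\<one>\<close> and \<open>z\<close> cancel.\<close>

lemma left_triv_lmult_rep: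
  assumes a: "a \<in> carrier G" and z: "z \<in> cdom M \<one>" "a \<otimes> z \<in> cdom M a"
  shows "left_triv G M a (lmult_rep a (cmap M \<one> z)) =
    lmult_rep_deriv a (cmap M \<one> z) o\<^sub>L left_triv G M \<one> (cmap M \<one> z)"
proof -
  have zc: "z \<in> carrier G" using z cdom_carrier[OF one_closed] by blast
  have "chart_trans M \<one> z z o\<^sub>L chart_trans M z \<one> z = chart_trans M z z z"
    by (rule chart_trans_compose[OF smooth]) (use z zc mem_cdom_carrier in auto)
  also have "\<dots> = id_blinfun" by (rule chart_trans_self[OF smooth]) (use z zc mem_cdom_carrier in auto)
  finally have "chart_trans M \<one> z z (chart_trans M z \<one> z v) = v" for v
    by (metis blinfun_apply_blinfun_compose blinfun_apply_id_blinfun)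
  then show ?thesis
    using a z zc smooth
    by (intro blinfun_eqI)
      (simp add: left_triv_def lmult_rep_def lmult_rep_deriv_def Let_def lmult_def[of G a] mderiv_lmult_mult)
qed

text \<open>In the chart at \<open>\<one>\<close> the left-invariant field of \<open>\<zeta>\<close>
  reads \<open>left_triv G M \<one> x \<zeta>\<close>, and its value at the identity is
  \<open>\<zeta>\<close> itself because translation by \<open>\<one>\<close> has identity
  derivative.\<close>

lemma lie_alg_bracket_eq:
  fixes B' :: "'e \<Rightarrow> 'e \<Rightarrow>\<^sub>L 'e"
  assumes B': "(left_triv G M \<one> has_derivative B') (at (cmap M \<one> \<one>))"
  shows "lie_alg_bracket G M \<xi> \<eta> = B' \<xi> \<eta> - B' \<eta> \<xi>"
proof -
  have "((\<lambda>x. left_triv G M \<one> x \<zeta>) has_derivative (\<lambda>v. B' v \<zeta>)) (at (cmap M \<one> \<one>))" for \<zeta>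
    using B' by (auto intro!: derivative_eq_intros)
  moreover have "field_rep M \<one> (\<lambda>x. mderiv M M (lmult G x) \<one> \<zeta>) = (\<lambda>x. left_triv G M \<one> x \<zeta>)" for \<zeta>
    by (rule ext) (simp add: field_rep_def left_triv_def Let_def)
  ultimately have "frechet_derivative (field_rep M \<one> (\<lambda>x. mderiv M M (lmult G x) \<one> \<zeta>)) (at (cmap M \<one> \<one>))
      = (\<lambda>v. B' v \<zeta>)" for \<zeta>
    by (metis frechet_derivative_at)
  then show ?thesis unfolding lie_alg_bracket_def lie_bracket_def by (simp add: mderiv_lmult_one)
qed

text \<open>
  Differentiating \<open>left_triv_lmult_rep\<close> produces a second derivative of the translation, which cancels
  in the bracket by symmetry.
\<close>

lemma mderiv_lmult_bracket:
  fixes A' :: "'e \<Rightarrow> 'e \<Rightarrow>\<^sub>L 'e"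
  assumes a: "a \<in> carrier G" and A': "(left_triv G M a has_derivative A') (at (cmap M a a))"
  defines "T \<equiv> mderiv M M (lmult G a) \<one>"
  shows "T (lie_alg_bracket G M \<xi> \<eta>) = A' (T \<xi>) \<eta> - A' (T \<eta>) \<xi>"
proof -
  let ?y = "cmap M \<one> \<one>"
  let ?W = "cmap M \<one> ` {z \<in> cdom M \<one>. a \<otimes> z \<in> cdom M a}"
  have W: "open ?W" "?y \<in> ?W"
    using open_lmult_rep_domain[OF a] a mem_cdom_carrier by auto
  obtain B' where B': "(left_triv G M \<one> has_derivative B') (at ?y)"
    using left_triv_differentiable[OF one_closed] mem_cdom_carrier unfolding differentiable_def by blast
  obtain D' where D': "(lmult_rep_deriv a has_derivative D') (at ?y)"
    using lmult_rep_deriv_differentiable[OF a] unfolding differentiable_def by blast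
  have sym: "D' u w = D' w u" for u w
    by (rule symmetric_second_derivative[OF W _ D']) (use lmult_rep_has_derivative a in auto)
  have y: "lmult_rep a ?y = cmap M a a"
    using a smooth mem_cdom_carrier by (simp add: lmult_rep_def lmult_def)
  have T: "lmult_rep_deriv a ?y = T"
    using a smooth mem_cdom_carrier
    by (simp add: lmult_rep_deriv_def Let_def T_def chart_trans_self)
  have one: "left_triv G M \<one> ?y = id_blinfun" by (simp add: left_triv_self mderiv_lmult_one)
  have la: "(lmult_rep a has_derivative T) (at ?y)"
    using lmult_rep_has_derivative[OF a, of \<one>] a mem_cdom_carrier by (simp add: T)
  have "((\<lambda>x. left_triv G M a (lmult_rep a x)) has_derivative (\<lambda>v. A' (T v))) (at ?y)"
    by (rule has_derivative_compose[OF la]) (use A' y in simp)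
  \<comment> \<open>The same operator-valued function is differentiated twice: here by the chain
    rule through \<open>lmult_rep a\<close>, next by the product rule.\<close>
  then have 1: "((\<lambda>x. lmult_rep_deriv a x o\<^sub>L left_triv G M \<one> x) has_derivative (\<lambda>v. A' (T v))) (at ?y)"
    by (rule has_derivative_transform_within_open[OF _ W]) (use left_triv_lmult_rep a in auto)
  have 2: "((\<lambda>x. lmult_rep_deriv a x o\<^sub>L left_triv G M \<one> x) has_derivative
      (\<lambda>v. (lmult_rep_deriv a ?y o\<^sub>L B' v) + (D' v o\<^sub>L left_triv G M \<one> ?y))) (at ?y)"
    by (rule bounded_bilinear.FDERIV[OF bounded_bilinear_blinfun_compose D' B'])
  \<comment> \<open>Comparing the two results isolates the second derivative \<open>D'\<close>,
    whose symmetry removes it on antisymmetrising.\<close>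
  have "A' (T v) w = T (B' v w) + D' v w" for v w
    using fun_cong[OF has_derivative_unique[OF 1 2], of v]
    by (simp add: T one blinfun.add_left)
  then show ?thesis
    unfolding lie_alg_bracket_eq[OF B'] by (simp add: blinfun.diff_right sym[of \<eta> \<xi>])
qed

end

section \<open>Reduction of Hamilton's equations\<close>

text \<open>Left invariance: moving the translation from \<open>f u\<close> onto the covector leaves
  the set of values to be minimised unchanged.\<close>

lemma control_hamiltonian_eq:
  "control_hamiltonian G M U f L g p =
    reduced_hamiltonian U f L (p o\<^sub>L mderiv M M (lmult G g) \<one>\<^bsub>G\<^esub>)"
  unfolding control_hamiltonian_def reduced_hamiltonian_def by (simp add: add.commute)

lemma blinfun_real_separates:
  fixes v w :: "'e::euclidean_space"
  assumes "\<And>\<nu> :: 'e \<Rightarrow>\<^sub>L real. \<nu> v = \<nu> w"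
  shows "v = w"
proof (rule euclidean_eqI)
  fix b :: 'e
  show "v \<bullet> b = w \<bullet> b" using assms[of "blinfun_inner_left b"] by simp
qed

context lie_group_manifold
begin

text \<open>The transitions between the charts at \<open>a\<close> and \<open>z\<close> cancel, so
  the reduced momentum can be computed from canonical coordinates in one fixed chart while the base
  point varies.\<close>

lemma left_triv_momentum:
  fixes P :: "'e \<Rightarrow>\<^sub>L real"
  assumes a: "a \<in> carrier G" and z: "z \<in> cdom M a"
  shows "(P o\<^sub>L chart_trans M a z z) o\<^sub>L left_triv G M a (cmap M a z) = P o\<^sub>L mderiv M M (lmult G z) \<one>"
proof -
  have zc: "z \<in> carrier G" using a z cdom_carrier by blast
  have "chart_trans M a z z o\<^sub>L chart_trans M z a z = chart_trans M z z z"
    by (rule chart_trans_compose[OF smooth]) (use a z zc mem_cdom_carrier in auto)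
  also have "\<dots> = id_blinfun" by (rule chart_trans_self[OF smooth]) (use zc mem_cdom_carrier in auto)
  finally have "chart_trans M a z z (chart_trans M z a z v) = v" for v
    by (metis blinfun_apply_blinfun_compose blinfun_apply_id_blinfun)
  then show ?thesis
    using a z smooth by (intro blinfun_eqI) (simp add: left_triv_def Let_def)
qed

context
  fixes H :: "'g \<Rightarrow> ('e \<Rightarrow>\<^sub>L real) \<Rightarrow> real" and h :: "('e \<Rightarrow>\<^sub>L real) \<Rightarrow> real"
  assumes left_invariant: "\<And>g p. H g p = h (p o\<^sub>L mderiv M M (lmult G g) \<one>)"
    and H: "cot_differentiable M H"
begin

lemma cot_rep_left_invariant: "cot_rep M H a (x, P) = h (P o\<^sub>L left_triv G M a x)"
proof -
  have "(P o\<^sub>L A) o\<^sub>L B = P o\<^sub>L (A o\<^sub>L B)" for A B :: "'e \<Rightarrow>\<^sub>L 'e"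
    by (rule blinfun_eqI) simp
  then show ?thesis by (simp add: cot_rep_def left_triv_def left_invariant Let_def)
qed

text \<open>Over the identity \<open>left_triv\<close> is the identity map, so \<open>h\<close> is
  the restriction of the coordinate Hamiltonian to that fibre.\<close>

lemma reduced_differentiable: "h differentiable (at \<mu>)"
proof -
  have "cot_rep M H \<one> differentiable (at (cmap M \<one> \<one>, \<mu>))"
    using H unfolding cot_differentiable_def by simp
  then have "(cot_rep M H \<one> \<circ> Pair (cmap M \<one> \<one>)) differentiable (at \<mu>)"
    by (intro differentiable_chain_at) (auto intro!: derivative_intros)
  moreover have "cot_rep M H \<one> \<circ> Pair (cmap M \<one> \<one>) = h"
    by (auto simp: cot_rep_left_invariant left_triv_self mderiv_lmult_one)
  ultimately show ?thesis by simp
qed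

lemma hamilton_equations_reduced:
  assumes c: "c t \<in> carrier G" and ham: "hamilton_equations M H c p t"
  defines "\<mu> \<equiv> \<lambda>s. p s o\<^sub>L mderiv M M (lmult G (c s)) \<one>"
  shows "has_velocity M c (mderiv M M (lmult G (c t)) \<one> (dual_differential h (\<mu> t))) t"
    and "(\<mu> has_vector_derivative coad G M (dual_differential h (\<mu> t)) (\<mu> t)) (at t)"
proof -
  define \<xi> where "\<xi> = dual_differential h (\<mu> t)"
  let ?a = "c t" and ?P = "\<lambda>s. p s o\<^sub>L chart_trans M (c t) (c s) (c s)"
  let ?x = "\<lambda>s. cmap M (c t) (c s)"
  define T where "T = mderiv M M (lmult G ?a) \<one>"
  have a: "?a \<in> cdom M ?a" using c by (rule mem_cdom_carrier)
  have T: "left_triv G M ?a (cmap M ?a ?a) = T" using c by (simp add: left_triv_self T_def)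
  obtain A' where A': "(left_triv G M ?a has_derivative A') (at (cmap M ?a ?a))"
    using left_triv_differentiable[OF c a] unfolding differentiable_def by blast
  interpret A': bounded_linear A' using A' by (rule has_derivative_bounded_linear)
  have "(h has_derivative frechet_derivative h (at (\<mu> t))) (at (\<mu> t))"
    using reduced_differentiable frechet_derivative_works by blast
  moreover have "frechet_derivative h (at (\<mu> t)) = (\<lambda>\<nu>. \<nu> \<xi>)"
    unfolding \<xi>_def using dual_differential_works[OF reduced_differentiable] by blast
  ultimately have h: "(h has_derivative (\<lambda>\<nu>. \<nu> \<xi>)) (at (\<mu> t))" by simp
  let ?z = "(cmap M ?a ?a, p t)"
  have 1: "((\<lambda>z. snd z o\<^sub>L left_triv G M ?a (fst z)) has_derivative
      (\<lambda>w. (p t o\<^sub>L A' (fst w)) + (snd w o\<^sub>L T))) (at ?z)"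
  proof -
    have fst': "(fst has_derivative fst) (at ?z)" and snd': "(snd has_derivative snd) (at ?z)"
      by (auto intro: bounded_linear_imp_has_derivative bounded_linear_fst bounded_linear_snd)
    have "((\<lambda>z. left_triv G M ?a (fst z)) has_derivative (\<lambda>w. A' (fst w))) (at ?z)"
      by (rule has_derivative_compose[OF fst']) (use A' in simp)
    from bounded_bilinear.FDERIV[OF bounded_bilinear_blinfun_compose snd' this]
    show ?thesis by (simp add: T)
  qed
  have "((\<lambda>z. h (snd z o\<^sub>L left_triv G M ?a (fst z))) has_derivative
      (\<lambda>w. ((p t o\<^sub>L A' (fst w)) + (snd w o\<^sub>L T)) \<xi>)) (at ?z)"
    by (rule has_derivative_compose[OF 1]) (use h in \<open>simp add: T T_def[symmetric] \<mu>_def\<close>)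
  moreover have "(\<lambda>z. h (snd z o\<^sub>L left_triv G M ?a (fst z))) = cot_rep M H ?a"
    by (auto simp: cot_rep_left_invariant)
  ultimately have "(cot_rep M H ?a has_derivative
      (\<lambda>w. ((p t o\<^sub>L A' (fst w)) + (snd w o\<^sub>L T)) \<xi>)) (at ?z)"
    by simp
  \<comment> \<open>The partial derivatives can now be read off: \<open>p t (A' v \<xi>)\<close> in
    direction \<open>(v, 0)\<close> and \<open>\<nu> (T \<xi>)\<close> in direction
    \<open>(0, \<nu>)\<close>, since \<open>A' 0 = 0\<close>.\<close>
  then have D: "frechet_derivative (cot_rep M H ?a) (at ?z)
      = (\<lambda>w. ((p t o\<^sub>L A' (fst w)) + (snd w o\<^sub>L T)) \<xi>)"
    by (rule frechet_derivative_at[symmetric])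
  from ham obtain v w where v: "has_velocity M c v t" "\<And>\<nu> :: 'e \<Rightarrow>\<^sub>L real. \<nu> v = \<nu> (T \<xi>)"
    and w: "(?P has_vector_derivative w) (at t)" "\<And>v. w v = - p t (A' v \<xi>)"
    unfolding hamilton_equations_def D Let_def
    by (auto simp: blinfun.add_left A'.zero)
  have vT: "v = T \<xi>" using v(2) by (rule blinfun_real_separates)
  then show "has_velocity M c (mderiv M M (lmult G (c t)) \<one> (dual_differential h (\<mu> t))) t"
    using v(1) by (simp add: T_def \<xi>_def)
  have x: "(?x has_derivative (\<lambda>r. r *\<^sub>R v)) (at t)" and ev: "\<forall>\<^sub>F s in nhds t. c s \<in> cdom M ?a"
    using v(1) unfolding has_velocity_def has_vector_derivative_def by auto
  have P: "(?P has_derivative (\<lambda>r. r *\<^sub>R w)) (at t)"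
    using w(1) unfolding has_vector_derivative_def by simp
  have Pt: "?P t = p t" using chart_trans_self[OF smooth _ a] c by simp
  have "((\<lambda>s. left_triv G M ?a (?x s)) has_derivative (\<lambda>r. A' (r *\<^sub>R v))) (at t)"
    by (rule has_derivative_compose[OF x A'])
  from bounded_bilinear.FDERIV[OF bounded_bilinear_blinfun_compose P this]
  have "((\<lambda>s. ?P s o\<^sub>L left_triv G M ?a (?x s)) has_derivative
      (\<lambda>r. (?P t o\<^sub>L A' (r *\<^sub>R v)) + (r *\<^sub>R w o\<^sub>L left_triv G M ?a (?x t)))) (at t)" .
  \<comment> \<open>The product rule was applied in the fixed chart at \<open>c t\<close>; for
    \<open>s\<close> near \<open>t\<close> the curve stays in its domain, where
    \<open>left_triv_momentum\<close> identifies the product with \<open>\<mu> s\<close>.\<close>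
  then have "(\<mu> has_derivative
      (\<lambda>r. (?P t o\<^sub>L A' (r *\<^sub>R v)) + (r *\<^sub>R w o\<^sub>L left_triv G M ?a (?x t)))) (at t)"
  proof (rule has_derivative_transform_eventually)
    show "\<forall>\<^sub>F s in at t. ?P s o\<^sub>L left_triv G M ?a (?x s) = \<mu> s"
      using ev[unfolded eventually_nhds_conv_at, THEN conjunct1]
      by eventually_elim (simp add: left_triv_momentum c \<mu>_def)
  qed (use c a left_triv_momentum \<mu>_def in auto)
  moreover have "(?P t o\<^sub>L A' (r *\<^sub>R v)) + (r *\<^sub>R w o\<^sub>L left_triv G M ?a (?x t))
      = r *\<^sub>R ((p t o\<^sub>L A' v) + (w o\<^sub>L T))" for r
    unfolding Pt T
    by (rule blinfun_eqI) (simp add: blinfun.add_left blinfun.scaleR_left A'.scaleR blinfun.scaleR_right algebra_simps)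
  ultimately have "(\<mu> has_vector_derivative (p t o\<^sub>L A' v) + (w o\<^sub>L T)) (at t)"
    unfolding has_vector_derivative_def by simp
  moreover have "coad G M \<xi> (\<mu> t) = (p t o\<^sub>L A' v) + (w o\<^sub>L T)"
  proof -
    have "(\<lambda>\<eta>. \<mu> t (lie_alg_bracket G M \<xi> \<eta>)) = blinfun_apply ((p t o\<^sub>L A' v) + (w o\<^sub>L T))"
    proof
      fix \<eta>
      have "\<mu> t (lie_alg_bracket G M \<xi> \<eta>) = p t (T (lie_alg_bracket G M \<xi> \<eta>))"
        by (simp add: \<mu>_def T_def)
      \<comment> \<open>The first term matches the motion of the base point, as
        \<open>v = T \<xi>\<close>; the second, paired with \<open>p t\<close>, is the force
        \<open>w\<close> evaluated at \<open>T \<eta>\<close>.\<close>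
      also have "T (lie_alg_bracket G M \<xi> \<eta>) = A' (T \<xi>) \<eta> - A' (T \<eta>) \<xi>"
        unfolding T_def by (rule mderiv_lmult_bracket[OF c A'])
      finally show "\<mu> t (lie_alg_bracket G M \<xi> \<eta>) = ((p t o\<^sub>L A' v) + (w o\<^sub>L T)) \<eta>"
        by (simp add: vT w(2) blinfun.add_left blinfun.diff_right)
    qed
    then show ?thesis unfolding coad_def by (simp add: blinfun_apply_inverse)
  qed
  ultimately show "(\<mu> has_vector_derivative coad G M (dual_differential h (\<mu> t)) (\<mu> t)) (at t)"
    by (simp add: \<xi>_def)
qed

end

text \<open>In the fixed chart at \<open>c t\<close> the momentum is a product of the continuous
  cotangent coordinates and \<open>left_triv\<close> along the base curve. Continuity within
  \<open>I\<close> covers the endpoints, where values before and after resets are taken.\<close>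

lemma continuous_on_momentum:
  assumes "cot_continuous_on M I c p"
  shows "continuous_on I (\<lambda>s. p s o\<^sub>L mderiv M M (lmult G (c s)) \<one>)"
  unfolding continuous_on_eq_continuous_within
proof
  fix t assume t: "t \<in> I"
  have c: "continuous_map (top_of_set I) (mtop M) c"
    and P: "continuous (at t within I) (\<lambda>s. p s o\<^sub>L chart_trans M (c t) (c s) (c s))"
    using assms t unfolding cot_continuous_on_def by auto
  have a: "c t \<in> carrier G" using continuous_map_image_subset_topspace[OF c] t by auto
  let ?x = "\<lambda>s. cmap M (c t) (c s)"
  \<comment> \<open>Used twice: a general \<open>T\<close> yields continuity of the coordinates of
    the curve, and \<open>T = UNIV\<close> merely keeps the curve in the chart domain.\<close>
  have near: "\<forall>\<^sub>F s in at t within I. c s \<in> cdom M (c t) \<and> ?x s \<in> T" if T: "open T" "?x t \<in> T" for T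
  proof -
    have "openin (top_of_set I) {s \<in> topspace (top_of_set I). c s \<in> {z \<in> cdom M (c t). cmap M (c t) z \<in> T}}"
      by (rule openin_continuous_map_preimage[OF c]) (use openin_cmap_preimage[OF smooth] a T in auto)
    then obtain O' where "open O'"
      and O': "{s \<in> I. c s \<in> {z \<in> cdom M (c t). cmap M (c t) z \<in> T}} = I \<inter> O'"
      unfolding openin_open by auto
    moreover have "t \<in> O'" using O' t a T mem_cdom_carrier by blast
    ultimately show ?thesis
      unfolding eventually_at_topological using O' by blast
  qed
  have "(?x \<longlongrightarrow> ?x t) (at t within I)"
    by (intro topological_tendstoI eventually_mono[OF near]) auto
  then have x: "continuous (at t within I) ?x" unfolding continuous_within .
  have "isCont (left_triv G M (c t)) (?x t)"
    using left_triv_differentiable[OF a mem_cdom_carrier[OF a]] differentiable_imp_continuous_within by blast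
  then have "continuous (at t within I) (\<lambda>s. left_triv G M (c t) (?x s))"
    using continuous_within_compose3[OF _ x] by blast
  with P have "continuous (at t within I)
      (\<lambda>s. (p s o\<^sub>L chart_trans M (c t) (c s) (c s)) o\<^sub>L left_triv G M (c t) (?x s))"
    by (rule bounded_bilinear.continuous[OF bounded_bilinear_blinfun_compose])
  then have "((\<lambda>s. (p s o\<^sub>L chart_trans M (c t) (c s) (c s)) o\<^sub>L left_triv G M (c t) (?x s))
      \<longlongrightarrow> p t o\<^sub>L mderiv M M (lmult G (c t)) \<one>) (at t within I)"
    unfolding continuous_within using a mem_cdom_carrier left_triv_momentum by simp
  moreover have "\<forall>\<^sub>F s in at t within I.
      (p s o\<^sub>L chart_trans M (c t) (c s) (c s)) o\<^sub>L left_triv G M (c t) (?x s)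
      = p s o\<^sub>L mderiv M M (lmult G (c s)) \<one>"
    using near[of UNIV] by (auto elim!: eventually_mono simp: a left_triv_momentum)
  ultimately show "continuous (at t within I) (\<lambda>s. p s o\<^sub>L mderiv M M (lmult G (c s)) \<one>)"
    unfolding continuous_within by (rule Lim_transform_eventually)
qed

section \<open>The quotient and the resets\<close>

text \<open>The coset of \<open>a \<otimes> z\<close> depends on \<open>a\<close> only through the
  coset of \<open>a\<close>, so both sides differentiate the same map at the identity. Hence the
  reduced velocity is independent of the chosen section.\<close>

lemma mderiv_qproj_left_invariant:
  fixes Q :: "('g set, 'f::euclidean_space) manifold"
  assumes Q: "quotient_manifold G M K Q" and K: "K \<lhd> G"
    and a: "a \<in> carrier G" and b: "b \<in> carrier G" and ab: "qproj G K a = qproj G K b"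
  shows "mderiv M Q (qproj G K) a o\<^sub>L mderiv M M (lmult G a) \<one>
    = mderiv M Q (qproj G K) b o\<^sub>L mderiv M M (lmult G b) \<one>"
proof -
  have smQ: "smooth_manifold Q" and \<pi>: "smooth_map M Q (qproj G K)"
    using Q unfolding quotient_manifold_def lie_group_def by auto
  have Ks: "K \<subseteq> carrier G" using K normal_imp_subgroup subgroup.subset by blast
  have comp: "mdifferentiable_at M Q (qproj G K \<circ> lmult G x) \<one>"
    "mderiv M Q (qproj G K \<circ> lmult G x) \<one> = mderiv M Q (qproj G K) x o\<^sub>L mderiv M M (lmult G x) \<one>"
    if x: "x \<in> carrier G" for x
  proof -
    have "lmult G x \<one> = x" using x by (simp add: lmult_def)
    moreover have "mdifferentiable_at M Q (qproj G K) x"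
      using smooth_map_imp_mdifferentiable_at[OF smooth smQ \<pi>] x by simp
    ultimately show "mdifferentiable_at M Q (qproj G K \<circ> lmult G x) \<one>"
      "mderiv M Q (qproj G K \<circ> lmult G x) \<one> = mderiv M Q (qproj G K) x o\<^sub>L mderiv M M (lmult G x) \<one>"
      using mdifferentiable_at_compose[OF smooth smooth lmult_mdifferentiable[OF x one_closed]] by auto
  qed
  have "(qproj G K \<circ> lmult G a) z = (qproj G K \<circ> lmult G b) z" if "z \<in> topspace (mtop M)" for z
    using that a b ab Ks coset_mult_assoc[of K a z] coset_mult_assoc[of K b z]
    by (simp add: qproj_def lmult_def)
  from mderiv_cong[OF smooth comp(1)[OF a] this] show ?thesis
    unfolding comp(2)[OF a, symmetric] comp(2)[OF b, symmetric] o_def by (rule sym)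
qed

section \<open>Conjugation, tangent vectors of the guard and the momentum jump\<close>

lemma tangent_space_of_image:
  assumes F: "mdifferentiable_at M M F x" and S: "F ` S \<subseteq> S'" and v: "v \<in> tangent_space_of M S x"
  shows "mderiv M M F x v \<in> tangent_space_of M S' (F x)"
proof -
  obtain c where c: "\<And>s. c s \<in> S" "c 0 = x" "has_velocity M c v 0"
    using v unfolding tangent_space_of_def by blast
  have "has_velocity M (\<lambda>s. F (c s)) (mderiv M M F (c 0) v) 0"
    by (rule has_velocity_compose[OF smooth smooth]) (use F c in auto)
  then show ?thesis using c S unfolding tangent_space_of_def by (auto intro!: exI[of _ "\<lambda>s. F (c s)"])
qed

text \<open>The chain rule identifies the composite defining \<open>Adj\<close> with the derivative
  of conjugation at the identity.\<close>

lemma conjugation_mdifferentiable: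
  assumes h: "h \<in> carrier G"
  shows "mdifferentiable_at M M (rmult G (inv h) \<circ> lmult G h) \<one>"
    and "mderiv M M (rmult G (inv h) \<circ> lmult G h) \<one> = Adj G M h"
proof -
  have e: "lmult G h \<one> = h" using h by (simp add: lmult_def)
  have "mdifferentiable_at M M (rmult G (inv h)) (lmult G h \<one>)"
    using h e by (simp add: rmult_mdifferentiable)
  from mdifferentiable_at_compose[OF smooth smooth lmult_mdifferentiable[OF h one_closed] this]
  show "mdifferentiable_at M M (rmult G (inv h) \<circ> lmult G h) \<one>"
    and "mderiv M M (rmult G (inv h) \<circ> lmult G h) \<one> = Adj G M h"
    by (auto simp: Adj_def e)
qed

text \<open>The auxiliary map \<open>F\<close> serves twice: it is a factor of left translation by
  \<open>g \<otimes> h\<close>, and it carries \<open>K\<close> into the guard when \<open>g\<close>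
  lies on the guard.\<close>

lemma lmult_conjugation_mdifferentiable:
  assumes g: "g \<in> carrier G" and h: "h \<in> carrier G"
  defines "F \<equiv> lmult G g \<circ> (rmult G (inv h) \<circ> lmult G h)"
  shows "mdifferentiable_at M M F \<one>" and "F \<one> = g"
    and "mderiv M M F \<one> = mderiv M M (lmult G g) \<one> o\<^sub>L Adj G M h"
proof -
  have e: "(rmult G (inv h) \<circ> lmult G h) \<one> = \<one>" using h by (simp add: lmult_def rmult_def)
  then show "F \<one> = g" using g by (simp add: F_def lmult_def)
  have "mdifferentiable_at M M (lmult G g) ((rmult G (inv h) \<circ> lmult G h) \<one>)"
    unfolding e using g by (simp add: lmult_mdifferentiable)
  from mdifferentiable_at_compose[OF smooth smooth conjugation_mdifferentiable(1)[OF h] this]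
  show "mdifferentiable_at M M F \<one>" and "mderiv M M F \<one> = mderiv M M (lmult G g) \<one> o\<^sub>L Adj G M h"
    unfolding F_def e conjugation_mdifferentiable(2)[OF h] .
qed

text \<open>Inserting \<open>inv h \<otimes> h\<close> puts the right translation by
  \<open>h\<close> outermost, where the derivative of the reset in the jump condition can absorb
  it.\<close>

lemma mderiv_lmult_mult_right:
  assumes g: "g \<in> carrier G" and h: "h \<in> carrier G"
  shows "mderiv M M (lmult G (g \<otimes> h)) \<one>
    = mderiv M M (rmult G h) g o\<^sub>L (mderiv M M (lmult G g) \<one> o\<^sub>L Adj G M h)"
proof -
  let ?F = "lmult G g \<circ> (rmult G (inv h) \<circ> lmult G h)"
  note F = lmult_conjugation_mdifferentiable[OF g h]
  have r: "mdifferentiable_at M M (rmult G h) (?F \<one>)"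
    unfolding F(2) by (rule rmult_mdifferentiable[OF h g])
  note comp = mdifferentiable_at_compose[OF smooth smooth F(1) r]
  have "mderiv M M (lmult G (g \<otimes> h)) \<one> = mderiv M M (rmult G h \<circ> ?F) \<one>"
    by (rule mderiv_cong[OF smooth comp(1)]) (use g h in \<open>simp add: lmult_def rmult_def m_assoc\<close>)
  then show ?thesis unfolding comp(2) F(2,3) .
qed

text \<open>Normality enters twice: conjugation by \<open>h\<close> preserves \<open>K\<close>, and
  the left coset of \<open>g\<close> equals its right coset, which is the guard. Curves in
  \<open>K\<close> through the identity are thus carried to curves in the guard through
  \<open>g\<close>.\<close>

lemma mderiv_lmult_Adj_tangent:
  assumes K: "K \<lhd> G" and g0: "g0 \<in> carrier G" and g: "g \<in> K #> g0" and h: "h \<in> carrier G"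
    and \<xi>: "\<xi> \<in> tangent_space_of M K \<one>"
  shows "mderiv M M (lmult G g) \<one> (Adj G M h \<xi>) \<in> tangent_space_of M (K #> g0) g"
proof -
  interpret K: normal K G by (rule K)
  let ?F = "lmult G g \<circ> (rmult G (inv h) \<circ> lmult G h)"
  have gc: "g \<in> carrier G" using g g0 r_coset_subset_G K.subset by blast
  note F = lmult_conjugation_mdifferentiable[OF gc h]
  have "?F ` K \<subseteq> K #> g0"
  proof
    fix y assume "y \<in> ?F ` K"
    then obtain k where k: "k \<in> K" "y = g \<otimes> (h \<otimes> k \<otimes> inv h)"
      by (auto simp: lmult_def rmult_def)
    have "h \<otimes> k \<otimes> inv h \<in> K" using k h K.inv_op_closed2 by blast
    then have "y \<in> g <# K" using k by (auto simp: l_coset_def)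
    also have "g <# K = K #> g" using K.coset_eq gc by simp
    also have "\<dots> = K #> g0" using repr_independence[OF g g0 K.subgroup_axioms] by simp
    finally show "y \<in> K #> g0" .
  qed
  from tangent_space_of_image[OF F(1) this \<xi>] show ?thesis
    unfolding F(2,3) blinfun_apply_blinfun_compose .
qed

lemma momentum_jump:
  fixes pm pp :: "'e \<Rightarrow>\<^sub>L real"
  assumes K: "K \<lhd> G" and g0: "g0 \<in> carrier G" and g: "g \<in> K #> g0" and h: "h \<in> carrier G"
    and jump: "(pp o\<^sub>L mderiv M M (rmult G h) g) - pm \<in> Ann (tangent_space_of M (K #> g0) g)"
  shows "\<exists>\<delta>\<in>Ann (tangent_space_of M K \<one>).
    pp o\<^sub>L mderiv M M (lmult G (rmult G h g)) \<one>
      = coAd G M h (pm o\<^sub>L mderiv M M (lmult G g) \<one>) + \<delta>"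
proof
  \<comment> \<open>The witness is the defect in the jump condition, pulled back to the Lie algebra
    by the map that sends tangent vectors of \<open>K\<close> to tangent vectors of the
    guard.\<close>
  let ?\<delta> = "((pp o\<^sub>L mderiv M M (rmult G h) g) - pm) o\<^sub>L (mderiv M M (lmult G g) \<one> o\<^sub>L Adj G M h)"
  have gc: "g \<in> carrier G"
    using g g0 r_coset_subset_G subgroup.subset[OF normal_imp_subgroup[OF K]] by blast
  show "pp o\<^sub>L mderiv M M (lmult G (rmult G h g)) \<one>
      = coAd G M h (pm o\<^sub>L mderiv M M (lmult G g) \<one>) + ?\<delta>"
    unfolding rmult_def mderiv_lmult_mult_right[OF gc h] coAd_def
    by (rule blinfun_eqI) (simp add: blinfun.add_left blinfun.diff_left)
  show "?\<delta> \<in> Ann (tangent_space_of M K \<one>)"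
    using jump mderiv_lmult_Adj_tangent[OF K g0 g h] unfolding Ann_def by auto
qed

end

section \<open>Reduced flow and jump conditions along a regular optimal trajectory\<close>

theorem theorem3:
  fixes G :: "'g monoid"
    and M :: "('g, 'e::euclidean_space) manifold"
    and K :: "'g set"
    and Q :: "('g set, real) manifold"
    and g0 h0 :: 'g
    and U :: "(real ^ 'm) set"
    and f :: "real ^ 'm \<Rightarrow> 'e"
    and L :: "real ^ 'm \<Rightarrow> real"
    and \<phi> :: "'g \<Rightarrow> real"
    and \<hh> :: "('e \<Rightarrow>\<^sub>L real) \<Rightarrow> real"
    and t0 tf :: real
    and N :: nat
    and \<tau> :: "nat \<Rightarrow> real"
    and g :: "nat \<Rightarrow> real \<Rightarrow> 'g"
    and p \<mu> :: "nat \<Rightarrow> real \<Rightarrow> 'e \<Rightarrow>\<^sub>L real"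
    and q :: "nat \<Rightarrow> real \<Rightarrow> 'g set"
  assumes "lie_group G M"
    and "closed_normal_lie_subgroup G M (DIM('e) - 1) K"
    and "quotient_manifold G M K Q"
    and "g0 \<in> carrier G" and "h0 \<in> carrier G" and "h0 \<notin> K"
    and "closed U"
    and "hamiltonian_well_defined G M U f L"
    and "cot_differentiable M (control_hamiltonian G M U f L)"
    and "\<hh> = reduced_hamiltonian U f L"
    and "regular_optimal_trajectory G M K g0 h0 U f L \<phi> t0 tf N \<tau> g p"
    and "\<And>j t. \<mu> j t = p j t o\<^sub>L mderiv M M (lmult G (g j t)) \<one>\<^bsub>G\<^esub>"
    and "\<And>j t. q j t = qproj G K (g j t)"
  shows
    "(\<forall>j\<le>N.
        continuous_on {\<tau> j..\<tau> (Suc j)} (\<mu> j) \<and>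
        continuous_map (top_of_set {\<tau> j..\<tau> (Suc j)}) (mtop Q) (q j) \<and>
        (\<forall>t\<in>{\<tau> j..<\<tau> (Suc j)}. q j t \<noteq> qproj G K g0) \<and>
        (\<forall>t\<in>{\<tau> j<..<\<tau> (Suc j)}.
           (\<mu> j has_vector_derivative coad G M (dual_differential \<hh> (\<mu> j t)) (\<mu> j t)) (at t) \<and>
           (\<forall>V \<sigma>. local_section G M K Q V \<sigma> \<and> q j t \<in> V \<longrightarrow>
              has_velocity Q (q j)
                (mderiv M Q (qproj G K) (\<sigma> (q j t))
                  (mderiv M M (lmult G (\<sigma> (q j t))) \<one>\<^bsub>G\<^esub> (dual_differential \<hh> (\<mu> j t)))) t))) \<and>
     (\<forall>j<N.
        q j (\<tau> (Suc j)) = qproj G K g0 \<and>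
        q (Suc j) (\<tau> (Suc j)) = q j (\<tau> (Suc j)) \<otimes>\<^bsub>G Mod K\<^esub> qproj G K h0 \<and>
        (\<exists>\<delta>\<mu>\<in>Ann (tangent_space_of M K \<one>\<^bsub>G\<^esub>).
           \<mu> (Suc j) (\<tau> (Suc j)) = coAd G M h0 (\<mu> j (\<tau> (Suc j))) + \<delta>\<mu> \<and>
           \<hh> (\<mu> (Suc j) (\<tau> (Suc j))) = \<hh> (\<mu> j (\<tau> (Suc j)))))"
proof -
  note lie = assms(1) and cls = assms(2) and Q = assms(3) and g0 = assms(4) and h0 = assms(5)
    and cot = assms(9) and hh = assms(10) and reg = assms(11)
  have \<mu>: "\<mu> j = (\<lambda>t. p j t o\<^sub>L mderiv M M (lmult G (g j t)) \<one>\<^bsub>G\<^esub>)" for j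
    using assms(12) by blast
  have q: "q j = (\<lambda>t. qproj G K (g j t))" for j using assms(13) by blast
  interpret lie_group_manifold G M by standard (rule lie)
  define H where "H = control_hamiltonian G M U f L"
  have K: "K \<lhd> G" using cls unfolding closed_normal_lie_subgroup_def by blast
  interpret K: normal K G by (rule K)
  have H: "H x P = \<hh> (P o\<^sub>L mderiv M M (lmult G x) \<one>\<^bsub>G\<^esub>)" for x P
    unfolding H_def hh by (rule control_hamiltonian_eq)
  have cot': "cot_differentiable M H" using cot unfolding H_def .
  obtain u where arc: "hybrid_arc G M K g0 h0 U f t0 tf N \<tau> g u"
    and hmp: "hybrid_maximum_principle G M K g0 h0 H \<phi> N \<tau> g p"
    using reg unfolding regular_optimal_trajectory_def optimal_arc_def H_def by blast
  have smQ: "smooth_manifold Q" "topspace (mtop Q) = carrier (G Mod K)" and \<pi>: "smooth_map M Q (qproj G K)"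
    using Q unfolding quotient_manifold_def lie_group_def by auto
  have \<pi>d: "mdifferentiable_at M Q (qproj G K) x" if "x \<in> carrier G" for x
    using smooth_map_imp_mdifferentiable_at[OF smooth smQ(1) \<pi>] that by simp
  \<comment> \<open>Together with \<open>\<pi>eq'\<close> this says that the guard is exactly the
    fibre of the projection over the coset of \<open>g0\<close>.\<close>
  have \<pi>eq: "x \<in> K #>\<^bsub>G\<^esub> y" if "x \<in> carrier G" "qproj G K x = qproj G K y" for x y
    using rcos_self[OF that(1) K.subgroup_axioms] that(2) unfolding qproj_def by simp
  have \<pi>eq': "qproj G K x = qproj G K g0" if "x \<in> K #>\<^bsub>G\<^esub> g0" for x
    unfolding qproj_def by (rule repr_independence[OF that g0 K.subgroup_axioms, symmetric])
  show ?thesis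
  proof (intro conjI allI impI ballI)
    fix j assume j: "j \<le> N"
    let ?I = "{\<tau> j..\<tau> (Suc j)}"
    have cc: "cot_continuous_on M ?I (g j) (p j)"
      and ham: "\<And>t. t \<in> {\<tau> j<..<\<tau> (Suc j)} \<Longrightarrow> hamilton_equations M H (g j) (p j) t"
      using hmp j unfolding hybrid_maximum_principle_def by auto
    have gc: "continuous_map (top_of_set ?I) (mtop M) (g j)"
      using cc unfolding cot_continuous_on_def by blast
    have gcar: "g j t \<in> carrier G" if "t \<in> ?I" for t
      using continuous_map_image_subset_topspace[OF gc] that by auto
    show "continuous_on ?I (\<mu> j)" unfolding \<mu> by (rule continuous_on_momentum[OF cc])
    show "continuous_map (top_of_set ?I) (mtop Q) (q j)"
      using continuous_map_compose[OF gc mdifferentiable_atD(3)[OF \<pi>d[OF one_closed]]]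
      unfolding q o_def .
    \<comment> \<open>The right endpoint is excluded: before the last piece ends, each piece ends on
      the guard, while flow is kept off it at earlier times.\<close>
    show "q j t \<noteq> qproj G K g0" if t: "t \<in> {\<tau> j..<\<tau> (Suc j)}" for t
    proof
      assume "q j t = qproj G K g0"
      then have "g j t \<in> K #>\<^bsub>G\<^esub> g0" using \<pi>eq gcar[of t] t unfolding q by simp
      moreover have "g j t \<notin> K #>\<^bsub>G\<^esub> g0" using arc j t unfolding hybrid_arc_def by blast
      ultimately show False by contradiction
    qed
    fix t assume t: "t \<in> {\<tau> j<..<\<tau> (Suc j)}"
    then have gt: "g j t \<in> carrier G" using gcar[of t] by simp
    note red = hamilton_equations_reduced[OF H cot' gt ham[OF t]]
    show "(\<mu> j has_vector_derivative coad G M (dual_differential \<hh> (\<mu> j t)) (\<mu> j t)) (at t)"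
      unfolding \<mu> by (rule red(2))
    fix V \<sigma> assume V: "local_section G M K Q V \<sigma> \<and> q j t \<in> V"
    let ?s = "\<sigma> (q j t)" and ?\<xi> = "dual_differential \<hh> (\<mu> j t)"
    have s: "qproj G K ?s = qproj G K (g j t)" using V unfolding local_section_def q by blast
    have "openin (mtop Q) V" and \<sigma>: "continuous_map (subtopology (mtop Q) V) (mtop M) \<sigma>"
      using V unfolding local_section_def smooth_map_on_def by auto
    then have "q j t \<in> topspace (subtopology (mtop Q) V)"
      using V openin_subset by (auto simp: topspace_subtopology)
    then have sc: "?s \<in> carrier G" using continuous_map_image_subset_topspace[OF \<sigma>] by auto
    \<comment> \<open>The velocity is first computed along the actual lift \<open>g j t\<close>,
      then moved to the lift given by the section, which lies in the same coset.\<close>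
    have "has_velocity Q (q j) (mderiv M Q (qproj G K) (g j t) (mderiv M M (lmult G (g j t)) \<one>\<^bsub>G\<^esub> ?\<xi>)) t"
      unfolding q \<mu> by (rule has_velocity_compose[OF smooth smQ(1) \<pi>d[OF gt] red(1)])
    moreover have "mderiv M Q (qproj G K) (g j t) (mderiv M M (lmult G (g j t)) \<one>\<^bsub>G\<^esub> v)
        = mderiv M Q (qproj G K) ?s (mderiv M M (lmult G ?s) \<one>\<^bsub>G\<^esub> v)" for v
      using mderiv_qproj_left_invariant[OF Q K gt sc s[symmetric]]
      by (metis blinfun_apply_blinfun_compose)
    ultimately show "has_velocity Q (q j)
        (mderiv M Q (qproj G K) ?s (mderiv M M (lmult G ?s) \<one>\<^bsub>G\<^esub> ?\<xi>)) t"
      by simp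
  next
    fix j assume j: "j < N"
    let ?t = "\<tau> (Suc j)"
    let ?gm = "g j ?t" and ?gp = "g (Suc j) ?t" and ?pm = "p j ?t" and ?pp = "p (Suc j) ?t"
    have gm: "?gm \<in> K #>\<^bsub>G\<^esub> g0" and gp: "?gp = rmult G h0 ?gm"
      using arc j unfolding hybrid_arc_def by auto
    have gmc: "?gm \<in> carrier G" using gm g0 r_coset_subset_G K.subset by blast
    have jump: "(?pp o\<^sub>L mderiv M M (rmult G h0) ?gm) - ?pm \<in> Ann (tangent_space_of M (K #>\<^bsub>G\<^esub> g0) ?gm)"
      and HH: "H ?gp ?pp = H ?gm ?pm"
      using hmp j unfolding hybrid_maximum_principle_def Let_def by auto
    show "q j ?t = qproj G K g0" unfolding q by (rule \<pi>eq'[OF gm])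
    show "q (Suc j) ?t = q j ?t \<otimes>\<^bsub>G Mod K\<^esub> qproj G K h0"
      \<comment> \<open>For normal \<open>K\<close> the product of cosets in the quotient group is
        the coset of the product.\<close>
      unfolding q gp using K.rcos_sum[OF gmc h0] by (simp add: qproj_def rmult_def FactGroup_def)
    show "\<exists>\<delta>\<mu>\<in>Ann (tangent_space_of M K \<one>\<^bsub>G\<^esub>).
        \<mu> (Suc j) ?t = coAd G M h0 (\<mu> j ?t) + \<delta>\<mu> \<and> \<hh> (\<mu> (Suc j) ?t) = \<hh> (\<mu> j ?t)"
      \<comment> \<open>Unfolding \<open>H\<close> through left trivialisation turns equality of the
        Hamiltonian across the reset into equality of \<open>\<hh>\<close> at the two
        momenta.\<close>
      using momentum_jump[OF K g0 gm h0 jump] HH unfolding \<mu> H gp by blast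
  qed
qed

end
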